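(* For all quantum channels $\mathcal{N}_1\colon A_1\to B_1$ and $\mathcal{N}_2\colon A_2\to B_2$ and all states $\sigma_1$ on $A_1$ and $\sigma_2$ on $A_2$, $$\max\{\eta_D(\mathcal{N}_1,\sigma_1),\eta_D(\mathcal{N}_2,\sigma_2)\}\leq\eta_D(\mathcal{N}_1\otimes\mathcal{N}_2,\sigma_1\otimes\sigma_2)\leq\max\{\zeta_{\mathrm{MI}}(\mathcal{N}_1\otimes\mathcal{N}_2),\eta_D(\mathcal{N}_1,\sigma_1),\eta_D(\mathcal{N}_2,\sigma_2)\}.$$
   Context: All systems are finite-dimensional. $D(\rho\|\sigma)=\operatorname{Tr}[\rho(\log\rho-\log\sigma)]$ if $\operatorname{supp}(\rho)\subseteq\operatorname{supp}(\sigma)$, else $+\infty$; $I(A:B)=D(\rho_{AB}\|\rho_A\otimes\rho_B)$. All ratio optimizations are over states with strictly positive and finite denominator (value $0$ if there are none). The SDPI constant is $$\eta_D(\mathcal{N},\sigma_A)=\sup_{\rho_A\neq\sigma_A}\frac{D(\mathcal{N}(\rho_A)\|\mathcal{N}(\sigma_A))}{D(\rho_A\|\sigma_A)}.$$ The mutual-information correlation coefficient of a bipartite channel $\mathcal{N}_{A_1A_2\to B_1B_2}$ is $$\zeta_{\mathrm{MI}}(\mathcal{N}_{A_1A_2\to B_1B_2})=\sup_{\rho_{A_1A_2}\ \text{not a product state}}\frac{I(B_1:B_2)}{I(A_1:A_2)},$$ with numerator evaluated on the output state $\mathcal{N}(\rho_{A_1A_2})$ and denominator on $\rho_{A_1A_2}$.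 *)

theory Defs
  imports "HOL-Analysis.Analysis"
begin

text \<open>
  A finite-dimensional system is a finite index type: its operators are the square complex
  matrices over that type, and a composite system is indexed by the product type.
\<close>

type_synonym 'a op = "complex ^ 'a ^ 'a"

subsection \<open>Operators\<close>

definition cinner :: "complex ^ 'n::finite \<Rightarrow> complex ^ 'n \<Rightarrow> complex" where
  "cinner u v = (\<Sum>i\<in>UNIV. cnj (u $ i) * v $ i)"

definition adj :: "'n::finite op \<Rightarrow> 'n op" where
  "adj A = (\<chi> i j. cnj (A $ j $ i))"

definition unitary_op :: "'n::finite op \<Rightarrow> bool" where
  "unitary_op U \<longleftrightarrow> adj U ** U = mat 1 \<and> U ** adj U = mat 1"

definition mscale :: "complex \<Rightarrow> 'n::finite op \<Rightarrow> 'n op" where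
  "mscale c A = (\<chi> i j. c * A $ i $ j)"

definition real_diag :: "('n::finite \<Rightarrow> real) \<Rightarrow> 'n op" where
  "real_diag d = (\<chi> i j. if i = j then complex_of_real (d i) else 0)"

definition mat_unit :: "'n::finite \<Rightarrow> 'n \<Rightarrow> 'n op" where
  "mat_unit i j = (\<chi> p q. if p = i \<and> q = j then 1 else 0)"

text \<open>Over the complex numbers, real nonnegativity of the form already forces hermiticity.\<close>

definition psd :: "'n::finite op \<Rightarrow> bool" where
  "psd A \<longleftrightarrow> (\<forall>v. cinner v (A *v v) \<in> \<real>\<^sub>\<ge>\<^sub>0)"

definition state :: "'n::finite op \<Rightarrow> bool" where
  "state \<rho> \<longleftrightarrow> psd \<rho> \<and> trace \<rho> = 1"

definition supp :: "'n::finite op \<Rightarrow> (complex ^ 'n) set" where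
  "supp A = {w. \<forall>v. A *v v = 0 \<longrightarrow> cinner v w = 0}"

text \<open>
  Functional calculus of a hermitian operator; the value does not depend on the choice of the
  spectral decomposition.
\<close>

definition op_fun :: "(real \<Rightarrow> real) \<Rightarrow> 'n::finite op \<Rightarrow> 'n op" where
  "op_fun f A = (THE B. \<exists>U d. unitary_op U \<and> A = U ** real_diag d ** adj U \<and>
                              B = U ** real_diag (f \<circ> d) ** adj U)"

text \<open>
  Natural logarithm, taken on the support and extended by zero to the kernel
  (so that \<open>0 log 0 = 0\<close>). The ratios below do not depend on the base of the logarithm.
\<close>

definition op_log :: "'n::finite op \<Rightarrow> 'n op" where
  "op_log = op_fun (\<lambda>x. if x = 0 then 0 else ln x)"

subsection \<open>Composite systems and channels\<close>

definition tensor :: "'a::finite op \<Rightarrow> 'b::finite op \<Rightarrow> ('a \<times> 'b) op" where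
  "tensor A B = (\<chi> p q. A $ fst p $ fst q * B $ snd p $ snd q)"

definition marginal1 :: "('a::finite \<times> 'b::finite) op \<Rightarrow> 'a op" where
  "marginal1 X = (\<chi> i j. \<Sum>k\<in>UNIV. X $ (i, k) $ (j, k))"

definition marginal2 :: "('a::finite \<times> 'b::finite) op \<Rightarrow> 'b op" where
  "marginal2 X = (\<chi> k l. \<Sum>i\<in>UNIV. X $ (i, k) $ (i, l))"

definition product_state :: "('a::finite \<times> 'b::finite) op \<Rightarrow> bool" where
  "product_state \<rho> \<longleftrightarrow> (\<exists>\<rho>1 \<rho>2. state \<rho>1 \<and> state \<rho>2 \<and> \<rho> = tensor \<rho>1 \<rho>2)"

text \<open>
  Positivity of the operator with blocks \<open>X i j\<close> (\<open>i, j < k\<close>) on the direct sum of \<open>k\<close> copies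
  of the system, i.e. on its tensor product with a \<open>k\<close>-dimensional ancilla. Blocks let the
  ancilla dimension be quantified, and \<open>N\<close> tensored with the identity acts on them entrywise.
\<close>

definition block_psd :: "nat \<Rightarrow> (nat \<Rightarrow> nat \<Rightarrow> 'n::finite op) \<Rightarrow> bool" where
  "block_psd k X \<longleftrightarrow>
     (\<forall>v. (\<Sum>i<k. \<Sum>j<k. cinner (v i) (X i j *v v j)) \<in> \<real>\<^sub>\<ge>\<^sub>0)"

definition completely_positive :: "('a::finite op \<Rightarrow> 'b::finite op) \<Rightarrow> bool" where
  "completely_positive N \<longleftrightarrow>
     (\<forall>k X. block_psd k X \<longrightarrow> block_psd k (\<lambda>i j. N (X i j)))"

definition channel :: "('a::finite op \<Rightarrow> 'b::finite op) \<Rightarrow> bool" where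
  "channel N \<longleftrightarrow> Vector_Spaces.linear mscale mscale N \<and> completely_positive N \<and>
                 (\<forall>X. trace (N X) = trace X)"

text \<open>
  The linear extension of \<open>A \<otimes> B \<mapsto> N1 A \<otimes> N2 B\<close>, written out on matrix units;
  see lemma \<open>tensor_map_tensor\<close>.
\<close>

definition tensor_map ::
    "('a1::finite op \<Rightarrow> 'b1::finite op) \<Rightarrow>
     ('a2::finite op \<Rightarrow> 'b2::finite op) \<Rightarrow>
     ('a1 \<times> 'a2) op \<Rightarrow> ('b1 \<times> 'b2) op" where
  "tensor_map N1 N2 X =
     (\<Sum>i\<in>UNIV. \<Sum>k\<in>UNIV. \<Sum>j\<in>UNIV. \<Sum>l\<in>UNIV.
        mscale (X $ (i, k) $ (j, l)) (tensor (N1 (mat_unit i j)) (N2 (mat_unit k l))))"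

lemma mat_unit_expansion: "A = (\<Sum>i\<in>UNIV. \<Sum>j\<in>UNIV. mscale (A $ i $ j) (mat_unit i j))"
proof -
  have "(\<Sum>i\<in>UNIV. \<Sum>j\<in>UNIV. mscale (A $ i $ j) (mat_unit i j)) $ p $ q = A $ p $ q" for p q
  proof -
    have "(\<Sum>i\<in>UNIV. \<Sum>j\<in>UNIV. mscale (A $ i $ j) (mat_unit i j)) $ p $ q =
        (\<Sum>i\<in>UNIV. \<Sum>j\<in>UNIV. A $ i $ j * (if p = i \<and> q = j then 1 else 0))"
      by (simp add: mscale_def mat_unit_def)
    also have "\<dots> =
        (\<Sum>i\<in>UNIV. if i = p then (\<Sum>j\<in>UNIV. if j = q then A $ i $ j else 0) else 0)"
      by (rule sum.cong[OF refl]) (simp add: if_distrib[of "(*) _"] cong: if_cong)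
    also have "\<dots> = A $ p $ q"
      by simp
    finally show ?thesis .
  qed
  then show ?thesis unfolding vec_eq_iff by metis
qed

lemma linear_mat_unit:
  assumes "Vector_Spaces.linear mscale mscale N"
  shows "N A = (\<Sum>i\<in>UNIV. \<Sum>j\<in>UNIV. mscale (A $ i $ j) (N (mat_unit i j)))"
proof -
  interpret Vector_Spaces.linear mscale mscale N by fact
  have "N A = N (\<Sum>i\<in>UNIV. \<Sum>j\<in>UNIV. mscale (A $ i $ j) (mat_unit i j))"
    using mat_unit_expansion[of A] by simp
  then show ?thesis by (simp add: sum scale)
qed

lemma tensor_map_tensor:
  assumes "Vector_Spaces.linear mscale mscale N1" and "Vector_Spaces.linear mscale mscale N2"
  shows "tensor_map N1 N2 (tensor A B) = tensor (N1 A) (N2 B)"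
proof -
  have "tensor_map N1 N2 (tensor A B) $ p $ q = tensor (N1 A) (N2 B) $ p $ q" for p q
  proof -
    have "tensor (N1 A) (N2 B) $ p $ q =
        (\<Sum>i\<in>UNIV. \<Sum>j\<in>UNIV. A $ i $ j * N1 (mat_unit i j) $ fst p $ fst q) *
        (\<Sum>k\<in>UNIV. \<Sum>l\<in>UNIV. B $ k $ l * N2 (mat_unit k l) $ snd p $ snd q)"
      by (simp add: tensor_def linear_mat_unit[OF assms(1), of A]
          linear_mat_unit[OF assms(2), of B] mscale_def)
    also have "\<dots> = (\<Sum>i\<in>UNIV. \<Sum>k\<in>UNIV. \<Sum>j\<in>UNIV. \<Sum>l\<in>UNIV.
        (A $ i $ j * N1 (mat_unit i j) $ fst p $ fst q) *
        (B $ k $ l * N2 (mat_unit k l) $ snd p $ snd q))"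
      by (simp only: sum_product)
    also have "\<dots> = tensor_map N1 N2 (tensor A B) $ p $ q"
      by (simp add: tensor_map_def tensor_def mscale_def mult_ac)
    finally show ?thesis by simp
  qed
  then show ?thesis by (simp add: vec_eq_iff)
qed

subsection \<open>Entropic quantities\<close>

definition rel_entropy :: "'n::finite op \<Rightarrow> 'n op \<Rightarrow> ereal" where
  "rel_entropy \<rho> \<sigma> =
     (if supp \<rho> \<subseteq> supp \<sigma> then ereal (Re (trace (\<rho> ** (op_log \<rho> - op_log \<sigma>)))) else \<infinity>)"

definition mutual_info :: "('a::finite \<times> 'b::finite) op \<Rightarrow> ereal" where
  "mutual_info \<rho> = rel_entropy \<rho> (tensor (marginal1 \<rho>) (marginal2 \<rho>))"

text \<open>
  Suprema of ratios range over the points of strictly positive and finite denominator; the value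
  is \<open>0\<close> if there are none (the supremum of the empty set in \<^typ>\<open>ereal\<close> would be \<open>-\<infinity>\<close>).
\<close>

definition sup_ratio :: "'s set \<Rightarrow> ('s \<Rightarrow> ereal) \<Rightarrow> ('s \<Rightarrow> ereal) \<Rightarrow> ereal" where
  "sup_ratio S f g =
     (let T = {x \<in> S. 0 < g x \<and> g x < \<infinity>} in if T = {} then 0 else (SUP x\<in>T. f x / g x))"

definition eta_D :: "('a::finite op \<Rightarrow> 'b::finite op) \<Rightarrow> 'a op \<Rightarrow> ereal" where
  "eta_D N \<sigma> = sup_ratio {\<rho>. state \<rho> \<and> \<rho> \<noteq> \<sigma>}
     (\<lambda>\<rho>. rel_entropy (N \<rho>) (N \<sigma>)) (\<lambda>\<rho>. rel_entropy \<rho> \<sigma>)"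

definition zeta_MI :: "(('a1::finite \<times> 'a2::finite) op \<Rightarrow>
     ('b1::finite \<times> 'b2::finite) op) \<Rightarrow> ereal" where
  "zeta_MI N = sup_ratio {\<rho>. state \<rho> \<and> \<not> product_state \<rho>}
     (\<lambda>\<rho>. mutual_info (N \<rho>)) mutual_info"

end

(* Relative entropy to a product state splits as
     D(rho || s1 (x) s2) = I(rho) + D(rho1 || s1) + D(rho2 || s2),
   and N1 (x) N2 maps the marginals of rho to N1 rho1 and N2 rho2, so the same splitting holds for
   the output. Each of the three output terms is bounded by the corresponding coefficient times
   its input term, also when the input term vanishes: by the equality case of Klein's inequality
   the state is then a product, respectively equal to the reference state, and so is the output.
   This gives the upper bound. The lower bound comes from
   the test states rho1 (x) s2 and s1 (x) rho2. *)

theory Submission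
  imports Defs
begin

section \<open>Operators\<close>

text \<open>The obstacle is the kernels: \<open>op_log\<close> vanishes on the kernel, so the
  logarithm of a tensor product need not be the sum of the local logarithms, and relative entropies
  may be infinite. The remedy is to pass to scalars. In an eigenbasis \<open>V\<close> of \<sigma>,
  both the support condition and the trace of \<rho> against the logarithm of \<sigma> see only the
  diagonal \<open>weight V \<rho>\<close>: support inclusion says that the weights vanish where the
  eigenvalues of \<sigma> do, and the trace is a weighted sum of scalar logarithms. In a product
  eigenbasis the splitting then holds term by term, because the terms where the scalar logarithm
  fails to be additive carry weight zero.

  Vanishing input terms need the equality case because the coefficients are suprema over positive
  finite denominators only and say nothing at denominator 0. Infinite terms cause no trouble in the
  upper bound: the three summands are nonnegative, so a finite total makes each of them
  finite.\<close>

lemma Re_cinner: "Re (cinner u v) = u \<bullet> v"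
  by (simp add: cinner_def inner_vec_def inner_complex_def)

lemma cinner_commute: "cinner v u = cnj (cinner u v)"
  by (simp add: cinner_def mult.commute)

lemma cinner_self: "cinner v v = complex_of_real ((norm v)\<^sup>2)"
proof -
  have "Im (cinner v v) = 0"
    by (simp add: cinner_def mult.commute)
  then show ?thesis
    by (simp add: complex_eq_iff Re_cinner power2_norm_eq_inner)
qed

lemma cinner_axis: "cinner (axis i 1) v = v $ i"
proof -
  have "cinner (axis i 1) v = (\<Sum>k\<in>UNIV. if k = i then v $ k else 0)"
    unfolding cinner_def by (rule sum.cong) (auto simp: axis_def)
  then show ?thesis by simp
qed

lemma cinner_matrix: "cinner u (A *v v) = (\<Sum>i\<in>UNIV. \<Sum>j\<in>UNIV. cnj (u $ i) * A $ i $ j * v $ j)"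
  by (simp add: cinner_def matrix_vector_mult_def sum_distrib_left mult_ac)

lemma cinner_adj: "cinner (adj A *v u) v = cinner u (A *v v)"
  unfolding cinner_matrix
  by (subst sum.swap) (simp add: cinner_def matrix_vector_mult_def adj_def sum_distrib_left mult_ac)

lemma adj_adj [simp]: "adj (adj A) = A"
  by (simp add: adj_def vec_eq_iff)

lemma adj_mult: "adj (A ** B) = adj B ** adj A"
  by (simp add: adj_def matrix_matrix_mult_def vec_eq_iff mult.commute)

lemma adj_real_diag [simp]: "adj (real_diag d) = real_diag d"
  by (simp add: adj_def real_diag_def vec_eq_iff)

lemma mult_real_diag: "(A ** real_diag d) $ i $ j = A $ i $ j * complex_of_real (d j)"
  by (simp add: matrix_matrix_mult_def real_diag_def if_distrib[of "(*) _"] cong: if_cong)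

lemma real_diag_mult: "(real_diag d ** A) $ i $ j = complex_of_real (d i) * A $ i $ j"
  by (simp add: matrix_matrix_mult_def real_diag_def if_distrib[of "\<lambda>x. x * _"] cong: if_cong)

lemma matrix_vector_mult_scaleR_complex: "(A :: 'n::finite op) *v (c *\<^sub>R x) = c *\<^sub>R (A *v x)"
  by (simp add: matrix_vector_mult_def vec_eq_iff scaleR_sum_right)

text \<open>Linearity over the reals is the form that the spectral theorem uses: it works in real
  subspaces with \<open>\<bullet>\<close>, the real part of \<open>cinner\<close>, so that
  continuity and compactness apply directly.\<close>

lemma linear_op: "linear ((*v) (A :: 'n::finite op))"
  by (intro linearI matrix_vector_right_distrib matrix_vector_mult_scaleR_complex)

section \<open>Spectral theorem and functional calculus\<close>

text \<open>A maximizer of the quadratic form on the unit sphere of an invariant subspace is an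
  eigenvector: the form \<open>\<lambda> - A\<close> is nonnegative on the subspace and vanishes at the maximizer,
  which forces \<open>(\<lambda> - A) v = 0\<close>.\<close>

lemma eigenvector_in_subspace:
  fixes A :: "'n::finite op"
  assumes herm: "adj A = A" and W: "subspace W" "closed W" and inv: "\<And>x. x \<in> W \<Longrightarrow> A *v x \<in> W"
    and x: "x \<in> W" "x \<noteq> 0"
  shows "\<exists>v l. v \<in> W \<and> norm v = 1 \<and> A *v v = l *\<^sub>R v"
proof -
  let ?S = "W \<inter> sphere 0 1"
  have comp: "compact ?S" using W by (simp add: closed_Int_compact)
  have "(1 / norm x) *\<^sub>R x \<in> ?S" using x W by (simp add: subspace_scale)
  then have ne: "?S \<noteq> {}" by blast
  have cont: "continuous_on ?S (\<lambda>y. y \<bullet> (A *v y))"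
    by (intro continuous_intros linear_continuous_on_compose[OF continuous_on_id linear_op])
  obtain v where v: "v \<in> ?S" and max: "\<And>y. y \<in> ?S \<Longrightarrow> y \<bullet> (A *v y) \<le> v \<bullet> (A *v v)"
    using continuous_attains_sup[OF comp ne cont] by blast
  define l where "l = v \<bullet> (A *v v)"
  define B where "B = (\<lambda>y. l *\<^sub>R y - A *v y)"
  have linB: "linear B"
    unfolding B_def using linear_op[of A] by (intro linear_compose_sub linear_scaleR) (auto simp: linear_scale_self)
  have sym: "y \<bullet> B z = z \<bullet> B y" for y z
  proof -
    have "y \<bullet> (A *v z) = z \<bullet> (A *v y)"
      using cinner_adj[of A y z] herm by (metis Re_cinner inner_commute)
    then show ?thesis by (simp add: B_def inner_diff_right inner_commute)
  qed
  have nonneg: "0 \<le> y \<bullet> B y" if "y \<in> W" for y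
  proof (cases "y = 0")
    case False
    define z where "z = (1 / norm y) *\<^sub>R y"
    have "z \<in> ?S" using that W False by (simp add: z_def subspace_scale)
    from max[OF this] have "0 \<le> z \<bullet> B z"
      using \<open>z \<in> ?S\<close> by (simp add: B_def inner_diff_right l_def power2_norm_eq_inner[symmetric])
    also have "z \<bullet> B z = (y \<bullet> B y) / (norm y)\<^sup>2"
      using linB by (simp add: z_def linear_cmul power2_eq_square)
    finally show ?thesis using False by (simp add: zero_le_divide_iff)
  qed simp
  have Bv0: "v \<bullet> B v = 0"
    using v by (simp add: B_def inner_diff_right l_def power2_norm_eq_inner[symmetric])
  define w where "w = B v"
  have wW: "w \<in> W"
    unfolding w_def B_def using v inv W by (simp add: subspace_diff subspace_scale)
  define m where "m = w \<bullet> B w"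
  \<comment> \<open>The form of \<open>B\<close> along the line \<open>v + t w\<close>. Its constant
    term vanishes at the maximizer, and since \<open>w = B v\<close> the linear coefficient is
    \<open>2 * (w \<bullet> w)\<close>; nonnegativity on both sides of \<open>t = 0\<close> forces
    it to vanish.\<close>
  have key: "0 \<le> 2 * t * (w \<bullet> w) + t\<^sup>2 * m" for t
  proof -
    have "0 \<le> (v + t *\<^sub>R w) \<bullet> B (v + t *\<^sub>R w)"
      using v wW W by (intro nonneg) (simp add: subspace_add subspace_scale)
    also have "\<dots> = v \<bullet> B v + t * (v \<bullet> B w) + t * (w \<bullet> B v) + t\<^sup>2 * m"
      using linB by (simp add: linear_add linear_cmul inner_add_left inner_add_right m_def
          power2_eq_square algebra_simps)
    also have "\<dots> = 2 * t * (w \<bullet> w) + t\<^sup>2 * m"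
      using Bv0 sym[of v w] by (simp add: w_def)
    finally show ?thesis .
  qed
  have "w \<bullet> w = 0"
  proof (rule ccontr)
    assume "w \<bullet> w \<noteq> 0"
    then have c: "w \<bullet> w > 0" by simp
    have m0: "m \<ge> 0" unfolding m_def by (rule nonneg[OF wW])
    \<comment> \<open>A negative \<open>t\<close> with \<open>t * m \<ge> - (w \<bullet> w)\<close>
      makes the expression in \<open>key\<close> negative; adding 1 keeps the denominator positive
      when \<open>m = 0\<close>.\<close>
    define t where "t = - (w \<bullet> w) / (m + 1)"
    have "t < 0" using c m0 by (simp add: t_def divide_neg_pos)
    moreover have "t * m \<ge> - (w \<bullet> w)" using c m0 by (simp add: t_def field_simps)
    ultimately have "t * (2 * (w \<bullet> w) + t * m) < 0" using c
      by (intro mult_neg_pos) linarith+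
    with key[of t] show False by (simp add: power2_eq_square algebra_simps)
  qed
  then have "A *v v = l *\<^sub>R v" by (simp add: w_def B_def)
  with v show ?thesis by auto
qed

text \<open>The orthogonal complement of eigenvectors of a hermitian operator is invariant, so a
  further eigenvector can be found there. The induction runs over subsets of the index type itself,
  which makes the final family indexed like the columns of a matrix.\<close>

lemma orthonormal_eigenvectors:
  fixes A :: "'n::finite op" and I :: "'n set"
  assumes herm: "adj A = A"
  shows "\<exists>u d. \<forall>i\<in>I. A *v u i = d i *\<^sub>R u i \<and> (\<forall>j\<in>I. cinner (u i) (u j) = (if i = j then 1 else 0))"
proof (induction I rule: finite_induct[OF finite])
  case (2 a I)
  then obtain u d where eig: "\<And>i. i \<in> I \<Longrightarrow> A *v u i = d i *\<^sub>R u i"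
    and orth: "\<And>i j. i \<in> I \<Longrightarrow> j \<in> I \<Longrightarrow> cinner (u i) (u j) = (if i = j then 1 else 0)"
    by metis
  define W where "W = {x. \<forall>i\<in>I. cinner (u i) x = 0}"
  have sub: "subspace W"
    by (auto simp: W_def subspace_def cinner_def distrib_left sum.distrib
        simp flip: scaleR_sum_right)
  have inv: "A *v x \<in> W" if "x \<in> W" for x
    unfolding W_def
  proof (intro CollectI ballI)
    fix i assume i: "i \<in> I"
    have "cinner (u i) (A *v x) = cinner (A *v u i) x"
      using cinner_adj[of A "u i" x] herm by simp
    also have "\<dots> = d i * cinner (u i) x"
      by (simp add: eig[OF i] cinner_def sum_distrib_left scaleR_conv_of_real[where 'a=complex] mult.assoc)
    finally show "cinner (u i) (A *v x) = 0" using that i by (simp add: W_def)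
  qed
  \<comment> \<open>A determinant replaces the dimension count: the row of the new index
    \<open>a\<close> is zero, so \<open>M\<close> is singular, and a kernel vector of
    \<open>M\<close> is orthogonal to all \<open>u i\<close> with \<open>i \<in> I\<close>.\<close>
  define M :: "'n op" where "M = (\<chi> i j. if i \<in> I then cnj (u i $ j) else 0)"
  have "row a M = 0" using 2(2) by (simp add: row_def M_def vec_eq_iff)
  then have "det M = 0" by (rule det_zero_row)
  then obtain x where x: "M *v x = 0" "x \<noteq> 0"
    using invertible_det_nz[of M] by (auto simp: invertible_left_inverse matrix_left_invertible_ker)
  have "x \<in> W"
    unfolding W_def
  proof (intro CollectI ballI)
    fix i assume "i \<in> I"
    then have "cinner (u i) x = (M *v x) $ i"
      by (simp add: cinner_def matrix_vector_mult_def M_def)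
    then show "cinner (u i) x = 0" using x by simp
  qed
  with eigenvector_in_subspace[OF herm sub closed_subspace[OF sub] inv] x
  obtain v l where v: "v \<in> W" "norm v = 1" "A *v v = l *\<^sub>R v" by blast
  have v_orth: "cinner (u i) v = 0" "cinner v (u i) = 0" if "i \<in> I" for i
    using v(1) that cinner_commute[of v "u i"] by (auto simp: W_def)
  show ?case
    using eig orth v v_orth 2(2) cinner_self[of v]
    by (intro exI[of _ "u(a := v)"] exI[of _ "d(a := l)"]) auto
qed simp

theorem spectral_decomposition:
  fixes A :: "'n::finite op"
  assumes "adj A = A"
  obtains U d where "unitary_op U" "A = U ** real_diag d ** adj U"
proof -
  obtain u :: "'n \<Rightarrow> complex ^ 'n" and d
    where eig: "\<And>i. A *v u i = d i *\<^sub>R u i"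
    and orth: "\<And>i j. cinner (u i) (u j) = (if i = j then 1 else 0)"
    using orthonormal_eigenvectors[OF assms, of UNIV] by (metis UNIV_I)
  define U :: "'n op" where "U = (\<chi> i j. u j $ i)"
  have "adj U ** U = mat 1"
    using orth by (simp add: adj_def U_def matrix_matrix_mult_def mat_def vec_eq_iff cinner_def)
  then have un: "unitary_op U"
    by (simp add: unitary_op_def matrix_left_right_inverse)
  have "(A ** U) $ i $ j = (U ** real_diag d) $ i $ j" for i j
  proof -
    have "(A ** U) $ i $ j = (A *v u j) $ i"
      by (simp add: matrix_matrix_mult_def matrix_vector_mult_def U_def)
    also have "\<dots> = (U ** real_diag d) $ i $ j"
      by (simp add: eig mult_real_diag U_def scaleR_conv_of_real[where 'a=complex] mult.commute)
    finally show ?thesis .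
  qed
  then have "A ** U = U ** real_diag d" by (simp add: vec_eq_iff)
  then have "A = U ** real_diag d ** adj U"
    using un by (metis matrix_mul_assoc matrix_mul_rid unitary_op_def)
  with un show thesis by (rule that)
qed

text \<open>Multiplying by \<open>adj V\<close> and \<open>U\<close> turns the equality into an
  intertwining relation for the overlap matrix \<open>adj V ** U\<close>, which is read entrywise.
  The right-hand side survives applying a function to \<open>d\<close> and \<open>e\<close>, which
  makes \<open>op_fun\<close> well defined; it is also the form in which the equality case of
  Klein's inequality appears.\<close>

lemma intertwine_eigenvalues:
  fixes U V :: "'n::finite op"
  assumes U: "unitary_op U" and V: "unitary_op V"
  shows "U ** real_diag d ** adj U = V ** real_diag e ** adj V \<longleftrightarrow>
    (\<forall>i j. (adj V ** U) $ i $ j \<noteq> 0 \<longrightarrow> d j = e i)" (is "?L \<longleftrightarrow> ?R")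
proof -
  have "?L \<longleftrightarrow> adj V ** U ** real_diag d = real_diag e ** (adj V ** U)"
  proof
    assume ?L
    then have "adj V ** (U ** real_diag d ** adj U) ** U = adj V ** (V ** real_diag e ** adj V) ** U"
      by simp
    then show "adj V ** U ** real_diag d = real_diag e ** (adj V ** U)"
      using U V unfolding unitary_op_def
      by (metis matrix_mul_assoc matrix_mul_rid matrix_mul_lid)
  next
    assume "adj V ** U ** real_diag d = real_diag e ** (adj V ** U)"
    then have "V ** (adj V ** U ** real_diag d) ** adj U = V ** (real_diag e ** (adj V ** U)) ** adj U"
      by simp
    then show ?L
      using U V unfolding unitary_op_def
      by (metis matrix_mul_assoc matrix_mul_rid matrix_mul_lid)
  qed
  also have "\<dots> \<longleftrightarrow> ?R"
    by (auto simp: vec_eq_iff mult_real_diag real_diag_mult mult.commute)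
  finally show ?thesis .
qed

lemma op_fun_eq:
  assumes U: "unitary_op U" and A: "A = U ** real_diag d ** adj U"
  shows "op_fun f A = U ** real_diag (f \<circ> d) ** adj U"
  unfolding op_fun_def
proof (rule the_equality)
  show "\<exists>Ua da. unitary_op Ua \<and> A = Ua ** real_diag da ** adj Ua \<and>
      U ** real_diag (f \<circ> d) ** adj U = Ua ** real_diag (f \<circ> da) ** adj Ua"
    using U A by blast
next
  fix B
  assume "\<exists>V e. unitary_op V \<and> A = V ** real_diag e ** adj V \<and> B = V ** real_diag (f \<circ> e) ** adj V"
  then obtain V e where V: "unitary_op V" "A = V ** real_diag e ** adj V"
    and B: "B = V ** real_diag (f \<circ> e) ** adj V" by blast
  have "U ** real_diag (f \<circ> d) ** adj U = V ** real_diag (f \<circ> e) ** adj V"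
    using intertwine_eigenvalues[OF U V(1)] A V(2) by (metis comp_apply)
  then show "B = U ** real_diag (f \<circ> d) ** adj U" using B by simp
qed

section \<open>Positive operators\<close>

text \<open>For a state \<open>X\<close> and a unitary \<open>V\<close>, these are the outcome
  probabilities of measuring \<open>X\<close> in the basis formed by the columns of
  \<open>V\<close>.\<close>

definition weight :: "'n::finite op \<Rightarrow> 'n op \<Rightarrow> 'n \<Rightarrow> real" where
  "weight V X j = Re ((adj V ** X ** V) $ j $ j)"

lemma Re_trace_spectral:
  "Re (trace (X ** (V ** real_diag f ** adj V))) = (\<Sum>j\<in>UNIV. f j * weight V X j)"
proof -
  have "trace (X ** (V ** real_diag f ** adj V)) = trace (adj V ** X ** V ** real_diag f)"
    using trace_mul_sym[of "X ** V ** real_diag f" "adj V"] by (simp add: matrix_mul_assoc)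
  then show ?thesis by (simp add: trace_def mult_real_diag weight_def mult.commute)
qed

lemma mult_axis: "A *v axis k 1 = column k (A :: 'n::finite op)"
  by (simp add: matrix_vector_mult_def column_def axis_def vec_eq_iff if_distrib[of "(*) _"] cong: if_cong)

lemma psd_hermitian:
  assumes "psd A"
  shows "adj A = A"
proof -
  have "cnj (A $ j $ i) = A $ i $ j" for i j
  proof (cases "i = j")
    case True
    from assms have "cinner (axis i 1) (A *v axis i 1) \<in> \<real>\<^sub>\<ge>\<^sub>0"
      by (simp add: psd_def)
    then show ?thesis
      using True by (simp add: cinner_axis mult_axis column_def complex_nonneg_Reals_iff complex_eq_iff)
  next
    case False
    have form: "cinner (axis i 1 + c *s axis j 1) (A *v (axis i 1 + c *s axis j 1)) =
        A $ i $ i + c * A $ i $ j + cnj c * A $ j $ i + cnj c * c * A $ j $ j" for c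
    proof -
      have "cinner (axis i 1 + c *s axis j 1) w = w $ i + cnj c * w $ j" for w
      proof -
        have "cinner (axis i 1 + c *s axis j 1) w =
            cinner (axis i 1) w + cnj c * cinner (axis j 1) w"
          by (simp add: cinner_def distrib_right sum.distrib sum_distrib_left mult.assoc)
        then show ?thesis by (simp add: cinner_axis)
      qed
      moreover have "A *v (axis i 1 + c *s axis j 1) = column i A + c *s column j A"
        by (simp add: matrix_vector_right_distrib vec.scale mult_axis)
      ultimately show ?thesis
        by (simp add: column_def algebra_simps)
    qed
    have im: "Im (cinner v (A *v v)) = 0" for v
      using assms by (simp add: psd_def complex_nonneg_Reals_iff)
    have diag: "Im (A $ k $ k) = 0" for k
      using im[of "axis k 1"] by (simp add: cinner_axis mult_axis column_def)
    \<comment> \<open>Polarization: once the diagonal is real, \<open>c = 1\<close> gives opposite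
      imaginary parts of \<open>A $ i $ j\<close> and \<open>A $ j $ i\<close>, and
      \<open>c = \<i>\<close> gives equal real parts.\<close>
    show ?thesis
      using im[of "axis i 1 + 1 *s axis j 1"] im[of "axis i 1 + \<i> *s axis j 1"] diag[of i] diag[of j]
      unfolding form by (simp add: complex_eq_iff)
  qed
  then show ?thesis by (simp add: adj_def vec_eq_iff)
qed

lemma psd_congruence:
  assumes "psd A"
  shows "psd (adj V ** A ** V)"
  unfolding psd_def
proof
  fix v
  have "cinner v (adj V ** A ** V *v v) = cinner (V *v v) (A *v (V *v v))"
    using cinner_adj[of "adj V" v "A *v (V *v v)"] by (simp flip: matrix_vector_mul_assoc)
  then show "cinner v (adj V ** A ** V *v v) \<in> \<real>\<^sub>\<ge>\<^sub>0"
    using assms by (simp add: psd_def)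
qed

lemma psd_diagonal:
  assumes "psd A"
  shows "A $ i $ i \<in> \<real>\<^sub>\<ge>\<^sub>0"
proof -
  have "cinner (axis i 1) (A *v axis i 1) = A $ i $ i"
    by (simp add: cinner_axis mult_axis column_def)
  then show ?thesis using assms by (metis psd_def)
qed

lemma weight_nonneg: "psd X \<Longrightarrow> 0 \<le> weight V X j"
  using psd_diagonal[OF psd_congruence, of X V j] by (simp add: weight_def complex_nonneg_Reals_iff)

lemma cinner_real_diag:
  "cinner v (real_diag d *v v) = complex_of_real (\<Sum>i\<in>UNIV. d i * (cmod (v $ i))\<^sup>2)"
proof -
  have "(real_diag d *v v) $ i = complex_of_real (d i) * v $ i" for i
    by (simp add: matrix_vector_mult_def real_diag_def if_distrib[of "\<lambda>x. x * _"] cong: if_cong)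
  then show ?thesis
    by (simp add: cinner_def complex_norm_square mult_ac del: of_real_power)
qed

lemma psd_real_diag: "(\<And>i. 0 \<le> d i) \<Longrightarrow> psd (real_diag d)"
  unfolding psd_def cinner_real_diag nonneg_Reals_of_real_iff by (simp add: sum_nonneg)

lemma psd_spectralI: "(\<And>i. 0 \<le> d i) \<Longrightarrow> psd (U ** real_diag d ** adj U)"
  using psd_congruence[OF psd_real_diag, of d "adj U"] by simp

lemma weight_eigenbasis:
  assumes "unitary_op U"
  shows "weight U (U ** real_diag d ** adj U) i = d i"
proof -
  have "adj U ** (U ** real_diag d ** adj U) ** U = real_diag d"
    using assms by (metis matrix_mul_assoc matrix_mul_lid matrix_mul_rid unitary_op_def)
  then show ?thesis by (simp add: weight_def real_diag_def)
qed

lemma psd_spectral_decomposition: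
  assumes "psd A"
  obtains U d where "unitary_op U" "A = U ** real_diag d ** adj U" "\<And>i. 0 \<le> d i"
proof -
  obtain U d where U: "unitary_op U" "A = U ** real_diag d ** adj U"
    using spectral_decomposition[OF psd_hermitian[OF assms]] .
  moreover have "0 \<le> d i" for i
    using weight_nonneg[OF assms, of U i] weight_eigenbasis[OF U(1)] U(2) by simp
  ultimately show thesis by (rule that)
qed

lemma trace_spectral:
  assumes "unitary_op U"
  shows "trace (U ** real_diag d ** adj U) = complex_of_real (\<Sum>i\<in>UNIV. d i)"
proof -
  have "trace (U ** real_diag d ** adj U) = trace (adj U ** (U ** real_diag d))"
    by (rule trace_mul_sym)
  also have "adj U ** (U ** real_diag d) = real_diag d"
    using assms by (simp add: matrix_mul_assoc unitary_op_def)
  finally show ?thesis by (simp add: trace_def real_diag_def)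
qed

text \<open>In an eigenbasis the form is a sum of nonnegative terms, so each of them vanishes. This
  promotes a vanishing weight to a vector in the kernel.\<close>

lemma psd_null_vector:
  assumes "psd A" and "cinner v (A *v v) = 0"
  shows "A *v v = 0"
proof -
  obtain U d where U: "unitary_op U" "A = U ** real_diag d ** adj U" and d: "\<And>i. 0 \<le> d i"
    using psd_spectral_decomposition[OF assms(1)] by metis
  define w where "w = adj U *v v"
  have Av: "A *v v = U *v (real_diag d *v w)"
    by (simp add: U(2) w_def matrix_vector_mul_assoc matrix_mul_assoc)
  have "cinner w (real_diag d *v w) = 0"
    using assms(2) cinner_adj[of U v "real_diag d *v w"] by (simp add: Av w_def)
  then have "(\<Sum>i\<in>UNIV. d i * (cmod (w $ i))\<^sup>2) = 0"
    unfolding cinner_real_diag by (simp only: of_real_eq_0_iff)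
  then have "\<forall>i. d i * (cmod (w $ i))\<^sup>2 = 0"
    using d by (simp add: sum_nonneg_eq_0_iff)
  then have "real_diag d *v w = 0"
    by (auto simp: matrix_vector_mult_def real_diag_def vec_eq_iff intro!: sum.neutral)
  then show ?thesis by (simp add: Av)
qed

text \<open>Supports are orthogonal complements of kernels, so the inclusion amounts to the kernel
  of \<sigma> lying in that of \<rho>. The kernel of \<sigma> is spanned by the columns of
  \<open>V\<close> with eigenvalue 0, and by positivity \<rho> annihilates such a column exactly
  when its weight is 0.\<close>

lemma supp_subset_iff:
  assumes \<rho>: "psd \<rho>" and V: "unitary_op V" and \<sigma>: "\<sigma> = V ** real_diag q ** adj V"
  shows "supp \<rho> \<subseteq> supp \<sigma> \<longleftrightarrow> (\<forall>j. q j = 0 \<longrightarrow> weight V \<rho> j = 0)"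
proof -
  have wt: "weight V \<rho> j = Re (cinner (V *v axis j 1) (\<rho> *v (V *v axis j 1)))" for j
  proof -
    have "cinner (V *v axis j 1) (\<rho> *v (V *v axis j 1)) =
        cinner (axis j 1) (adj V ** \<rho> ** V *v axis j 1)"
      using cinner_adj[of "adj V" "axis j 1"] by (simp flip: matrix_vector_mul_assoc)
    then show ?thesis
      by (simp add: weight_def cinner_axis mult_axis column_def)
  qed
  have \<sigma>v: "\<sigma> *v x = V *v (real_diag q *v (adj V *v x))" for x
    by (simp add: \<sigma> matrix_vector_mul_assoc matrix_mul_assoc)
  have diag: "(real_diag q *v x) $ i = complex_of_real (q i) * x $ i" for x i
    by (simp add: matrix_vector_mult_def real_diag_def if_distrib[of "\<lambda>x. x * _"] cong: if_cong)
  have VV: "adj V *v (V *v x) = x" "V *v (adj V *v x) = x" for x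
    using V by (simp_all add: matrix_vector_mul_assoc unitary_op_def)
  show ?thesis
  proof
    assume sub: "supp \<rho> \<subseteq> supp \<sigma>"
    show "\<forall>j. q j = 0 \<longrightarrow> weight V \<rho> j = 0"
    proof (intro allI impI)
      fix j assume q: "q j = 0"
      let ?v = "V *v axis j 1"
      have "real_diag q *v axis j 1 = 0"
        using q by (auto simp: vec_eq_iff diag axis_def)
      then have "\<sigma> *v ?v = 0" by (simp add: \<sigma>v VV)
      \<comment> \<open>A hermitian operator has its range in its support; pairing this vector with
        \<open>?v\<close>, which \<sigma> annihilates, produces the weight.\<close>
      moreover have "\<rho> *v ?v \<in> supp \<rho>"
        unfolding supp_def
      proof (intro CollectI allI impI)
        fix x assume "\<rho> *v x = 0"
        then show "cinner x (\<rho> *v ?v) = 0"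
          using cinner_adj[of \<rho> x ?v] psd_hermitian[OF \<rho>] by (simp add: cinner_def)
      qed
      ultimately have "cinner ?v (\<rho> *v ?v) = 0" using sub by (auto simp: supp_def)
      then show "weight V \<rho> j = 0" by (simp add: wt)
    qed
  next
    assume w0: "\<forall>j. q j = 0 \<longrightarrow> weight V \<rho> j = 0"
    have ker: "\<rho> *v (V *v axis j 1) = 0" if "q j = 0" for j
    proof (rule psd_null_vector[OF \<rho>])
      have "cinner (V *v axis j 1) (\<rho> *v (V *v axis j 1)) \<in> \<real>\<^sub>\<ge>\<^sub>0"
        using \<rho> by (simp add: psd_def)
      then show "cinner (V *v axis j 1) (\<rho> *v (V *v axis j 1)) = 0"
        using w0 that by (simp add: wt complex_nonneg_Reals_iff complex_eq_iff)
    qed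
    have "\<rho> *v x = 0" if "\<sigma> *v x = 0" for x
    proof -
      define y where "y = adj V *v x"
      have "real_diag q *v y = 0"
        using arg_cong[OF that, of "(*v) (adj V)"] by (simp add: \<sigma>v VV y_def)
      \<comment> \<open>In the eigenbasis, a kernel vector of \<sigma> has nonzero coordinates only
        at zero eigenvalues.\<close>
      then have y: "q j = 0 \<or> y $ j = 0" for j
        using diag[of y j] by simp
      have "\<rho> *v x = (\<rho> ** V) *v y"
        by (simp add: y_def VV flip: matrix_vector_mul_assoc)
      also have "\<dots> = (\<Sum>j\<in>UNIV. y $ j *s column j (\<rho> ** V))"
        by (rule matrix_mult_sum)
      also have "\<dots> = 0"
      proof (intro sum.neutral ballI)
        fix j
        have "column j (\<rho> ** V) = \<rho> *v (V *v axis j 1)"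
          by (simp add: matrix_vector_mul_assoc flip: mult_axis)
        then show "y $ j *s column j (\<rho> ** V) = 0" using y[of j] ker[of j] by auto
      qed
      finally show ?thesis .
    qed
    then show "supp \<rho> \<subseteq> supp \<sigma>" by (auto simp: supp_def)
  qed
qed

section \<open>Klein's inequality\<close>

abbreviation ln0 :: "real \<Rightarrow> real" where
  "ln0 x \<equiv> if x = 0 then 0 else ln x"

lemma op_log_spectral:
  "unitary_op U \<Longrightarrow> op_log (U ** real_diag d ** adj U) = U ** real_diag (\<lambda>i. ln0 (d i)) ** adj U"
  unfolding op_log_def by (subst op_fun_eq) (auto simp: comp_def)

text \<open>This is the tangent bound \<open>ln x \<le> x - 1\<close> at \<open>x = q / p\<close>,
  multiplied by \<open>p\<close>, with its equality case \<open>x = 1\<close>. The correction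
  \<open>- p + q\<close> makes every single term nonnegative and sums to zero for normalized
  spectra.\<close>

lemma klein_scalar:
  assumes p: "0 \<le> p" and q: "(0::real) < q"
  shows "0 \<le> p * ln0 p - p * ln q - p + q"
    and "p * ln0 p - p * ln q - p + q = 0 \<Longrightarrow> p = q"
proof -
  have "0 \<le> p * ln0 p - p * ln q - p + q \<and> (p * ln0 p - p * ln q - p + q = 0 \<longrightarrow> p = q)"
  proof (cases "p = 0")
    case False
    with p have p: "p > 0" by simp
    have eq: "p * ln0 p - p * ln q - p + q = p * ((q / p - 1) - ln (q / p))"
      using p q by (simp add: ln_div field_simps)
    have "0 \<le> (q / p - 1) - ln (q / p)"
      using ln_le_minus_one[of "q / p"] p q by simp
    moreover have "p = q" if "(q / p - 1) - ln (q / p) = 0"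
      using ln_eq_minus_one[of "q / p"] p q that by simp
    ultimately show ?thesis using p unfolding eq by simp
  qed (use q in auto)
  then show "0 \<le> p * ln0 p - p * ln q - p + q"
    and "p * ln0 p - p * ln q - p + q = 0 \<Longrightarrow> p = q" by auto
qed

lemma mult_diff_right: "A ** (B - C) = A ** B - A ** (C :: 'n::finite op)"
  by (simp add: matrix_matrix_mult_def vec_eq_iff right_diff_distrib sum_subtractf)

lemma rel_entropy_self [simp]: "rel_entropy \<rho> \<rho> = 0"
  by (simp add: rel_entropy_def trace_def)

text \<open>The squared overlaps \<open>P i j\<close> of the two eigenbases form a doubly stochastic
  matrix, and the relative entropy is the classical divergence of the joint distributions
  \<open>p i * P i j\<close> and \<open>q j * P i j\<close>. Vanishing forces
  \<open>p i = q j\<close> wherever the overlap is nonzero, which by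
  \<open>intertwine_eigenvalues\<close> means that the two states coincide.\<close>

lemma rel_entropy_klein:
  assumes \<rho>: "state \<rho>" and \<sigma>: "state \<sigma>"
  shows "0 \<le> rel_entropy \<rho> \<sigma>" and "rel_entropy \<rho> \<sigma> = 0 \<longleftrightarrow> \<rho> = \<sigma>"
proof -
  have "0 \<le> rel_entropy \<rho> \<sigma> \<and> (rel_entropy \<rho> \<sigma> = 0 \<longrightarrow> \<rho> = \<sigma>)"
  proof (cases "supp \<rho> \<subseteq> supp \<sigma>")
    case True
    obtain U p where U: "unitary_op U" and \<rho>eq: "\<rho> = U ** real_diag p ** adj U"
      and p: "\<And>i. 0 \<le> p i"
      using psd_spectral_decomposition \<rho> unfolding state_def by metis
    obtain V q where V: "unitary_op V" and \<sigma>eq: "\<sigma> = V ** real_diag q ** adj V"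
      and q: "\<And>i. 0 \<le> q i"
      using psd_spectral_decomposition \<sigma> unfolding state_def by metis
    define W where "W = adj U ** V"
    define P where "P i j = (cmod (W $ i $ j))\<^sup>2" for i j
    have WW: "W ** adj W = mat 1" "adj W ** W = mat 1"
      using U V unfolding W_def adj_mult adj_adj unitary_op_def
      by (metis matrix_mul_assoc matrix_mul_rid)+
    have "complex_of_real (\<Sum>j\<in>UNIV. P i j) = (W ** adj W) $ i $ i" for i
      by (simp add: P_def matrix_matrix_mult_def adj_def complex_norm_square del: of_real_power)
    then have rows: "(\<Sum>j\<in>UNIV. P i j) = 1" for i
      by (simp add: WW mat_def del: of_real_sum)
    have "complex_of_real (\<Sum>i\<in>UNIV. P i j) = (adj W ** W) $ j $ j" for j
      by (simp add: P_def matrix_matrix_mult_def adj_def complex_norm_square mult.commute del: of_real_power)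
    then have cols: "(\<Sum>i\<in>UNIV. P i j) = 1" for j
      by (simp add: WW mat_def del: of_real_sum)
    have wt: "weight V \<rho> j = (\<Sum>i\<in>UNIV. p i * P i j)" for j
    proof -
      have "adj V ** \<rho> ** V = adj W ** (real_diag p ** W)"
        by (simp add: \<rho>eq W_def adj_mult matrix_mul_assoc)
      moreover have "(adj W ** Y) $ j $ j = (\<Sum>i\<in>UNIV. cnj (W $ i $ j) * Y $ i $ j)" for Y
        by (simp add: matrix_matrix_mult_def adj_def)
      ultimately have "(adj V ** \<rho> ** V) $ j $ j =
          (\<Sum>i\<in>UNIV. cnj (W $ i $ j) * (complex_of_real (p i) * W $ i $ j))"
        by (simp add: real_diag_mult)
      also have "\<dots> = complex_of_real (\<Sum>i\<in>UNIV. p i * P i j)"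
        by (simp add: P_def complex_norm_square mult_ac del: of_real_power)
      finally show ?thesis by (simp add: weight_def)
    qed
    \<comment> \<open>Support inclusion removes every term with \<open>q j = 0\<close>, so the value
      0 that \<open>ln0\<close> assigns there is harmless.\<close>
    have null: "p i * P i j = 0" if "q j = 0" for i j
    proof -
      have "(\<Sum>i\<in>UNIV. p i * P i j) = 0"
        using supp_subset_iff[of \<rho>, OF _ V \<sigma>eq] \<rho> True that by (simp add: wt state_def)
      then show ?thesis using p by (simp add: sum_nonneg_eq_0_iff P_def)
    qed
    have tr: "(\<Sum>i\<in>UNIV. p i) = 1" "(\<Sum>j\<in>UNIV. q j) = 1"
      using \<rho> \<sigma> trace_spectral[OF U, of p] trace_spectral[OF V, of q]
      by (simp_all add: state_def \<rho>eq \<sigma>eq del: of_real_sum)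
    \<comment> \<open>The added \<open>- p i + q j\<close> contributes \<open>- 1 + 1 = 0\<close> in
      total, by the row and column sums of \<open>P\<close> and the unit traces.\<close>
    define T where "T i j = P i j * (p i * ln0 (p i) - p i * ln0 (q j) - p i + q j)" for i j
    have "Re (trace (\<rho> ** (op_log \<rho> - op_log \<sigma>))) =
        Re (trace (\<rho> ** op_log \<rho>)) - Re (trace (\<rho> ** op_log \<sigma>))"
      by (simp add: mult_diff_right trace_sub)
    also have "\<dots> = (\<Sum>i\<in>UNIV. ln0 (p i) * p i) - (\<Sum>j\<in>UNIV. ln0 (q j) * weight V \<rho> j)"
      unfolding \<sigma>eq op_log_spectral[OF V] Re_trace_spectral
      unfolding \<rho>eq op_log_spectral[OF U] Re_trace_spectral weight_eigenbasis[OF U] by (rule refl)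
    also have "(\<Sum>i\<in>UNIV. ln0 (p i) * p i) = (\<Sum>i\<in>UNIV. \<Sum>j\<in>UNIV. P i j * (p i * ln0 (p i)))"
      by (simp add: rows mult.commute flip: sum_distrib_right)
    also have "(\<Sum>j\<in>UNIV. ln0 (q j) * weight V \<rho> j) =
        (\<Sum>i\<in>UNIV. \<Sum>j\<in>UNIV. P i j * (p i * ln0 (q j)))"
      by (subst sum.swap) (simp add: wt sum_distrib_left sum_distrib_right mult_ac)
    finally have D: "Re (trace (\<rho> ** (op_log \<rho> - op_log \<sigma>))) =
        (\<Sum>i\<in>UNIV. \<Sum>j\<in>UNIV. P i j * (p i * ln0 (p i))) -
        (\<Sum>i\<in>UNIV. \<Sum>j\<in>UNIV. P i j * (p i * ln0 (q j)))" .
    have "(\<Sum>i\<in>UNIV. \<Sum>j\<in>UNIV. P i j * p i) = 1"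
      by (simp add: rows tr flip: sum_distrib_right)
    moreover have "(\<Sum>i\<in>UNIV. \<Sum>j\<in>UNIV. P i j * q j) = 1"
      by (subst sum.swap) (simp add: cols tr flip: sum_distrib_right)
    ultimately have DT: "Re (trace (\<rho> ** (op_log \<rho> - op_log \<sigma>))) = (\<Sum>i\<in>UNIV. \<Sum>j\<in>UNIV. T i j)"
      unfolding D T_def by (simp add: distrib_left right_diff_distrib sum.distrib sum_subtractf)
    have T0: "0 \<le> T i j" for i j
    proof (cases "q j = 0")
      case True
      then show ?thesis using null[of j i] by (auto simp: T_def)
    next
      case False
      then show ?thesis
        using klein_scalar(1)[OF p[of i], of "q j"] q[of j] by (simp add: T_def P_def)
    qed
    have "\<rho> = \<sigma>" if "(\<Sum>i\<in>UNIV. \<Sum>j\<in>UNIV. T i j) = 0"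
    proof -
      have T: "T i j = 0" for i j
        using that T0 by (simp add: sum_nonneg_eq_0_iff sum_nonneg)
      have "p i = q j" if "W $ i $ j \<noteq> 0" for i j
      proof (cases "q j = 0")
        case True
        then show ?thesis using null[of j i] that by (simp add: P_def)
      next
        case False
        then show ?thesis
          using klein_scalar(2)[OF p[of i], of "q j"] q[of j] T[of i j] that
          by (simp add: T_def P_def)
      qed
      moreover have "(adj V ** U) $ i $ j = cnj (W $ j $ i)" for i j
      proof -
        have "adj V ** U = adj W" by (simp add: W_def adj_mult)
        then show ?thesis by (simp add: adj_def)
      qed
      ultimately show ?thesis
        unfolding \<rho>eq \<sigma>eq intertwine_eigenvalues[OF U V] by simp
    qed
    then show ?thesis using True T0 by (simp add: rel_entropy_def DT sum_nonneg)
  qed (simp add: rel_entropy_def)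
  then show "0 \<le> rel_entropy \<rho> \<sigma>" and "rel_entropy \<rho> \<sigma> = 0 \<longleftrightarrow> \<rho> = \<sigma>"
    by (auto simp: rel_entropy_def trace_def)
qed

section \<open>Composite systems\<close>

lemma sum_UNIV_prod: "(\<Sum>p\<in>(UNIV :: ('a::finite \<times> 'b::finite) set). f p) = (\<Sum>i\<in>UNIV. \<Sum>k\<in>UNIV. f (i, k))"
  by (simp add: sum.cartesian_product flip: UNIV_Times_UNIV)

lemma tensor_mult: "tensor A B ** tensor C D = tensor (A ** C) (B ** D)"
  by (simp add: tensor_def matrix_matrix_mult_def vec_eq_iff sum_UNIV_prod sum_product mult_ac)

lemma adj_tensor: "adj (tensor A B) = tensor (adj A) (adj B)"
  by (simp add: adj_def tensor_def vec_eq_iff)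

lemma tensor_one: "tensor (mat 1) (mat 1) = mat 1"
  by (simp add: tensor_def mat_def vec_eq_iff)

lemma tensor_real_diag: "tensor (real_diag d) (real_diag e) = real_diag (\<lambda>p. d (fst p) * e (snd p))"
  by (auto simp: tensor_def real_diag_def vec_eq_iff)

lemma unitary_tensor: "unitary_op V \<Longrightarrow> unitary_op W \<Longrightarrow> unitary_op (tensor V W)"
  by (simp add: unitary_op_def adj_tensor tensor_mult tensor_one)

lemma unitary_one: "unitary_op (mat 1)"
proof -
  have "adj (mat 1) = (mat 1 :: 'n::finite op)" by (auto simp: adj_def mat_def vec_eq_iff)
  then show ?thesis by (simp add: unitary_op_def)
qed

lemma tensor_spectral:
  "tensor (V ** real_diag d ** adj V) (W ** real_diag e ** adj W) =
     tensor V W ** real_diag (\<lambda>p. d (fst p) * e (snd p)) ** adj (tensor V W)"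
  by (simp add: adj_tensor tensor_mult flip: tensor_real_diag)

text \<open>Expanding the identity in a freely chosen basis makes \<open>tensor Z (mat 1)\<close>
  diagonal in the product basis that suits the other factor.\<close>

lemma spectral_one:
  fixes W :: "'n::finite op"
  assumes "unitary_op W"
  shows "W ** real_diag (\<lambda>_. 1) ** adj W = mat 1"
proof -
  have "real_diag (\<lambda>_. 1) = (mat 1 :: 'n::finite op)" by (simp add: real_diag_def mat_def vec_eq_iff)
  then show ?thesis using assms by (simp add: unitary_op_def)
qed

lemma trace_tensor: "trace (tensor A B) = trace A * trace B"
  by (simp add: trace_def tensor_def sum_UNIV_prod sum_product)

lemma psd_tensor:
  assumes "psd A" and "psd B"
  shows "psd (tensor A B)"
proof -
  obtain V d where A: "A = V ** real_diag d ** adj V" and d: "\<And>i. 0 \<le> d i"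
    using psd_spectral_decomposition[OF assms(1)] by metis
  obtain W e where B: "B = W ** real_diag e ** adj W" and e: "\<And>i. 0 \<le> e i"
    using psd_spectral_decomposition[OF assms(2)] by metis
  show ?thesis unfolding A B tensor_spectral by (rule psd_spectralI) (simp add: d e)
qed

lemma state_tensor: "state A \<Longrightarrow> state B \<Longrightarrow> state (tensor A B)"
  by (simp add: state_def psd_tensor trace_tensor)

lemma marginal1_tensor: "marginal1 (tensor A B) = mscale (trace B) A"
  by (simp add: marginal1_def tensor_def mscale_def trace_def vec_eq_iff sum_distrib_left mult.commute)

lemma marginal2_tensor: "marginal2 (tensor A B) = mscale (trace A) B"
  by (simp add: marginal2_def tensor_def mscale_def trace_def vec_eq_iff sum_distrib_right)

lemma mscale_one [simp]: "mscale 1 A = A"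
  by (simp add: mscale_def vec_eq_iff)

lemma trace_marginal1: "trace (marginal1 X ** Z) = trace (X ** tensor Z (mat 1))"
proof -
  have "trace (X ** tensor Z (mat 1)) =
      (\<Sum>i\<in>UNIV. \<Sum>k\<in>UNIV. \<Sum>j\<in>UNIV. X $ (i, k) $ (j, k) * Z $ j $ i)"
    by (simp add: trace_def matrix_matrix_mult_def tensor_def mat_def sum_UNIV_prod
        if_distrib[of "(*) _"] cong: if_cong)
  also have "\<dots> = (\<Sum>i\<in>UNIV. \<Sum>j\<in>UNIV. \<Sum>k\<in>UNIV. X $ (i, k) $ (j, k) * Z $ j $ i)"
    by (rule sum.cong[OF refl]) (rule sum.swap)
  also have "\<dots> = trace (marginal1 X ** Z)"
    by (simp add: trace_def matrix_matrix_mult_def marginal1_def sum_distrib_right)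
  finally show ?thesis by simp
qed

lemma trace_marginal2: "trace (marginal2 X ** Z) = trace (X ** tensor (mat 1) Z)"
proof -
  have "trace (X ** tensor (mat 1) Z) =
      (\<Sum>i\<in>UNIV. \<Sum>k\<in>UNIV. \<Sum>j\<in>UNIV. \<Sum>l\<in>UNIV. if j = i then X $ (i, k) $ (j, l) * Z $ l $ k else 0)"
    by (simp add: trace_def matrix_matrix_mult_def tensor_def mat_def sum_UNIV_prod
        if_distrib[of "\<lambda>x. x * _"] if_distrib[of "(*) _"] cong: if_cong)
  also have "\<dots> = (\<Sum>i\<in>UNIV. \<Sum>k\<in>UNIV. \<Sum>l\<in>UNIV. \<Sum>j\<in>UNIV. if j = i then X $ (i, k) $ (j, l) * Z $ l $ k else 0)"
    by (intro sum.cong[OF refl]) (rule sum.swap)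
  also have "\<dots> = (\<Sum>k\<in>UNIV. \<Sum>i\<in>UNIV. \<Sum>l\<in>UNIV. X $ (i, k) $ (i, l) * Z $ l $ k)"
    by (subst sum.swap) simp
  also have "\<dots> = (\<Sum>k\<in>UNIV. \<Sum>l\<in>UNIV. \<Sum>i\<in>UNIV. X $ (i, k) $ (i, l) * Z $ l $ k)"
    by (rule sum.cong[OF refl]) (rule sum.swap)
  also have "\<dots> = trace (marginal2 X ** Z)"
    by (simp add: trace_def matrix_matrix_mult_def marginal2_def sum_distrib_right)
  finally show ?thesis by simp
qed

text \<open>Since \<open>W\<close> is free, traces of both marginals become sums over the same
  weights in one product basis, with a function of one coordinate each; they can then be added
  termwise.\<close>

lemma trace_marginal1_spectral:
  assumes "unitary_op W"
  shows "Re (trace (marginal1 X ** (V ** real_diag f ** adj V))) =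
    (\<Sum>p\<in>UNIV. f (fst p) * weight (tensor V W) X p)"
  unfolding trace_marginal1 spectral_one[OF assms, symmetric] tensor_spectral Re_trace_spectral
  by simp

lemma trace_marginal2_spectral:
  assumes "unitary_op V"
  shows "Re (trace (marginal2 X ** (W ** real_diag f ** adj W))) =
    (\<Sum>p\<in>UNIV. f (snd p) * weight (tensor V W) X p)"
  unfolding trace_marginal2 spectral_one[OF assms, symmetric] tensor_spectral Re_trace_spectral
  by simp

text \<open>The outcome distribution of a marginal is the classical marginal of the joint one; the
  indicator of \<open>j\<close>, used as the diagonal function, singles out the entry.\<close>

lemma weight_marginal1:
  assumes "unitary_op W"
  shows "weight V (marginal1 X) j = (\<Sum>k\<in>UNIV. weight (tensor V W) X (j, k))"
proof -
  let ?f = "\<lambda>i. if i = j then 1 else (0::real)"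
  have "weight V (marginal1 X) j = (\<Sum>i\<in>UNIV. ?f i * weight V (marginal1 X) i)"
    by (simp add: if_distrib[of "\<lambda>x. x * _"] cong: if_cong)
  also have "\<dots> = (\<Sum>p\<in>UNIV. ?f (fst p) * weight (tensor V W) X p)"
    using trace_marginal1_spectral[OF assms, of X V ?f] by (simp add: Re_trace_spectral)
  also have "\<dots> = (\<Sum>i\<in>UNIV. if i = j then \<Sum>k\<in>UNIV. weight (tensor V W) X (i, k) else 0)"
    unfolding sum_UNIV_prod by (rule sum.cong) auto
  finally show ?thesis by simp
qed

lemma weight_marginal2:
  assumes "unitary_op V"
  shows "weight W (marginal2 X) k = (\<Sum>j\<in>UNIV. weight (tensor V W) X (j, k))"
proof -
  let ?f = "\<lambda>i. if i = k then 1 else (0::real)"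
  have "weight W (marginal2 X) k = (\<Sum>i\<in>UNIV. ?f i * weight W (marginal2 X) i)"
    by (simp add: if_distrib[of "\<lambda>x. x * _"] cong: if_cong)
  also have "\<dots> = (\<Sum>p\<in>UNIV. ?f (snd p) * weight (tensor V W) X p)"
    using trace_marginal2_spectral[OF assms, of X W ?f] by (simp add: Re_trace_spectral)
  also have "\<dots> = (\<Sum>j\<in>UNIV. weight (tensor V W) X (j, k))"
    by (simp add: sum_UNIV_prod if_distrib[of "\<lambda>x. x * _"] cong: if_cong)
  finally show ?thesis .
qed

text \<open>After hermiticity has supplied an eigenbasis, the eigenvalues are sums of nonnegative
  weights of \<open>X\<close>. Any basis of the traced-out factor would serve; the standard one is
  taken.\<close>

lemma psd_marginal1:
  fixes X :: "('a::finite \<times> 'b::finite) op"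
  assumes "psd X"
  shows "psd (marginal1 X)"
proof -
  have "cnj (X $ p $ q) = X $ q $ p" for p q
    using psd_hermitian[OF assms] by (metis (no_types, lifting) adj_def vec_lambda_beta)
  then have "adj (marginal1 X) = marginal1 X" by (simp add: adj_def marginal1_def vec_eq_iff)
  then obtain V d where V: "unitary_op V" "marginal1 X = V ** real_diag d ** adj V"
    by (rule spectral_decomposition)
  have "d j = (\<Sum>k\<in>UNIV. weight (tensor V (mat 1)) X (j, k))" for j
    using weight_marginal1[OF unitary_one, of V X j] V by (simp add: weight_eigenbasis)
  then show ?thesis
    unfolding V(2) using weight_nonneg[OF assms] by (intro psd_spectralI) (simp add: sum_nonneg)
qed

lemma psd_marginal2:
  fixes X :: "('a::finite \<times> 'b::finite) op"
  assumes "psd X"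
  shows "psd (marginal2 X)"
proof -
  have "cnj (X $ p $ q) = X $ q $ p" for p q
    using psd_hermitian[OF assms] by (metis (no_types, lifting) adj_def vec_lambda_beta)
  then have "adj (marginal2 X) = marginal2 X" by (simp add: adj_def marginal2_def vec_eq_iff)
  then obtain V d where V: "unitary_op V" "marginal2 X = V ** real_diag d ** adj V"
    by (rule spectral_decomposition)
  have "d k = (\<Sum>j\<in>UNIV. weight (tensor (mat 1) V) X (j, k))" for k
    using weight_marginal2[OF unitary_one, of V X k] V by (simp add: weight_eigenbasis)
  then show ?thesis
    unfolding V(2) using weight_nonneg[OF assms] by (intro psd_spectralI) (simp add: sum_nonneg)
qed

lemma state_marginals:
  assumes "state X"
  shows "state (marginal1 X)" and "state (marginal2 X)"
proof -
  have "trace (marginal1 X) = trace X" "trace (marginal2 X) = trace X"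
    using trace_marginal1[of X "mat 1"] trace_marginal2[of X "mat 1"] by (simp_all add: tensor_one)
  then show "state (marginal1 X)" and "state (marginal2 X)"
    using assms by (simp_all add: state_def psd_marginal1 psd_marginal2)
qed

section \<open>Chain rule for the relative entropy\<close>

text \<open>An eigenvalue \<open>q j * r k\<close> vanishes exactly when a factor does, and a
  marginal weight, being a sum of nonnegative joint weights, vanishes exactly when all of them
  do.\<close>

lemma supp_tensor_iff:
  assumes \<rho>: "psd \<rho>" and \<sigma>: "psd \<sigma>1" "psd \<sigma>2"
  shows "supp \<rho> \<subseteq> supp (tensor \<sigma>1 \<sigma>2) \<longleftrightarrow>
    supp (marginal1 \<rho>) \<subseteq> supp \<sigma>1 \<and> supp (marginal2 \<rho>) \<subseteq> supp \<sigma>2"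
proof -
  obtain V q where V: "unitary_op V" and \<sigma>1: "\<sigma>1 = V ** real_diag q ** adj V"
    using psd_spectral_decomposition[OF \<sigma>(1)] by metis
  obtain W r where W: "unitary_op W" and \<sigma>2: "\<sigma>2 = W ** real_diag r ** adj W"
    using psd_spectral_decomposition[OF \<sigma>(2)] by metis
  show ?thesis
    unfolding supp_subset_iff[OF \<rho> unitary_tensor[OF V W], of "tensor \<sigma>1 \<sigma>2", unfolded \<sigma>1 \<sigma>2, OF tensor_spectral]
      \<sigma>1 \<sigma>2 supp_subset_iff[OF psd_marginal1[OF \<rho>] V refl] supp_subset_iff[OF psd_marginal2[OF \<rho>] W refl]
      weight_marginal1[OF W] weight_marginal2[OF V]
    using weight_nonneg[OF \<rho>] by (auto simp: sum_nonneg_eq_0_iff)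
qed

text \<open>With the logarithm set to 0 on the kernel, additivity can fail where exactly one factor
  has eigenvalue 0. The support hypothesis gives those positions weight 0, so the identity holds
  under the trace against \<rho>.\<close>

lemma trace_log_tensor:
  assumes \<rho>: "psd \<rho>" and \<sigma>: "psd \<sigma>1" "psd \<sigma>2" and supp: "supp \<rho> \<subseteq> supp (tensor \<sigma>1 \<sigma>2)"
  shows "Re (trace (\<rho> ** op_log (tensor \<sigma>1 \<sigma>2))) =
    Re (trace (marginal1 \<rho> ** op_log \<sigma>1)) + Re (trace (marginal2 \<rho> ** op_log \<sigma>2))"
proof -
  obtain V q where V: "unitary_op V" and \<sigma>1: "\<sigma>1 = V ** real_diag q ** adj V" and q: "\<And>i. 0 \<le> q i"
    using psd_spectral_decomposition[OF \<sigma>(1)] by metis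
  obtain W r where W: "unitary_op W" and \<sigma>2: "\<sigma>2 = W ** real_diag r ** adj W" and r: "\<And>i. 0 \<le> r i"
    using psd_spectral_decomposition[OF \<sigma>(2)] by metis
  have null: "weight (tensor V W) \<rho> p = 0" if "q (fst p) * r (snd p) = 0" for p
    using supp that
    unfolding supp_subset_iff[OF \<rho> unitary_tensor[OF V W], of "tensor \<sigma>1 \<sigma>2", unfolded \<sigma>1 \<sigma>2, OF tensor_spectral]
      \<sigma>1 \<sigma>2 by blast
  have log: "ln0 (q (fst p) * r (snd p)) * weight (tensor V W) \<rho> p =
      ln0 (q (fst p)) * weight (tensor V W) \<rho> p + ln0 (r (snd p)) * weight (tensor V W) \<rho> p" for p
  proof (cases "q (fst p) * r (snd p) = 0")
    case True
    then show ?thesis using null by simp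
  next
    case False
    with q[of "fst p"] r[of "snd p"] have "0 < q (fst p)" "0 < r (snd p)"
      by (auto simp: order_less_le)
    then show ?thesis by (simp add: ln_mult distrib_right)
  qed
  show ?thesis
    unfolding \<sigma>1 \<sigma>2 tensor_spectral op_log_spectral[OF unitary_tensor[OF V W]]
      op_log_spectral[OF V] op_log_spectral[OF W] trace_marginal1_spectral[OF W]
      trace_marginal2_spectral[OF V]
    unfolding Re_trace_spectral sum.distrib[symmetric]
    by (rule sum.cong[OF refl log])
qed

text \<open>A positive \<rho> is always supported in the product of its marginals, so the logarithm
  rule applies to that product as well as to the reference state; the traces of the marginals
  against their own logarithms then cancel.\<close>

theorem rel_entropy_tensor:
  assumes \<rho>: "state \<rho>" and \<sigma>: "state \<sigma>1" "state \<sigma>2"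
  shows "rel_entropy \<rho> (tensor \<sigma>1 \<sigma>2) =
    mutual_info \<rho> + rel_entropy (marginal1 \<rho>) \<sigma>1 + rel_entropy (marginal2 \<rho>) \<sigma>2"
proof -
  have psd: "psd \<rho>" "psd \<sigma>1" "psd \<sigma>2" "psd (marginal1 \<rho>)" "psd (marginal2 \<rho>)"
    using \<rho> \<sigma> state_marginals[OF \<rho>] by (simp_all add: state_def)
  have supp: "supp \<rho> \<subseteq> supp (tensor (marginal1 \<rho>) (marginal2 \<rho>))"
    using psd by (simp add: supp_tensor_iff)
  show ?thesis
  proof (cases "supp \<rho> \<subseteq> supp (tensor \<sigma>1 \<sigma>2)")
    case True
    then show ?thesis
      using supp psd trace_log_tensor[OF psd(1,2,3) True] trace_log_tensor[OF psd(1,4,5) supp]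
        supp_tensor_iff[OF psd(1,2,3)]
      by (simp add: mutual_info_def rel_entropy_def mult_diff_right trace_sub)
  next
    \<comment> \<open>By \<open>supp_tensor_iff\<close> a marginal term is already infinite, while
      the mutual information is finite, so both sides are \<infinity>.\<close>
    case False
    then show ?thesis
      using supp supp_tensor_iff[OF psd(1,2,3)]
      by (auto simp: mutual_info_def rel_entropy_def)
  qed
qed

lemma mutual_info_tensor:
  "state A \<Longrightarrow> state B \<Longrightarrow> mutual_info (tensor A B) = 0"
  by (simp add: mutual_info_def marginal1_tensor marginal2_tensor state_def)

lemma mutual_info_nonneg: "state \<rho> \<Longrightarrow> 0 \<le> mutual_info \<rho>"
  unfolding mutual_info_def by (intro rel_entropy_klein state_tensor state_marginals)

lemma mutual_info_eq_0D:
  assumes "state \<rho>" and "mutual_info \<rho> = 0"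
  shows "product_state \<rho>"
proof -
  have "\<rho> = tensor (marginal1 \<rho>) (marginal2 \<rho>)"
    using assms rel_entropy_klein(2)[OF assms(1) state_tensor[OF state_marginals[OF assms(1)]]]
    by (simp add: mutual_info_def)
  then show ?thesis
    using state_marginals[OF assms(1)] unfolding product_state_def by blast
qed

section \<open>Product channels\<close>

text \<open>Enumerating the index type carries complete positivity over to blocks indexed by a
  finite type, so that the other system of a composite can act as the ancilla.\<close>

lemma completely_positive_blocks:
  fixes X :: "'c::finite \<Rightarrow> 'c \<Rightarrow> 'a::finite op"
  assumes cp: "completely_positive N"
    and X: "\<And>v. (\<Sum>c\<in>UNIV. \<Sum>d\<in>UNIV. cinner (v c) (X c d *v v d)) \<in> \<real>\<^sub>\<ge>\<^sub>0"
  shows "(\<Sum>c\<in>UNIV. \<Sum>d\<in>UNIV. cinner (v c) (N (X c d) *v v d)) \<in> \<real>\<^sub>\<ge>\<^sub>0"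
proof -
  obtain h where h: "bij_betw h {..<CARD('c)} (UNIV :: 'c set)"
    using ex_bij_betw_nat_finite[OF finite, of UNIV] by (metis atLeast0LessThan)
  have reindex: "(\<Sum>i<CARD('c). \<Sum>j<CARD('c). F (h i) (h j)) = (\<Sum>c\<in>UNIV. \<Sum>d\<in>UNIV. F c d)"
    for F :: "'c \<Rightarrow> 'c \<Rightarrow> complex"
    using sum.reindex_bij_betw[OF h, of "\<lambda>c. \<Sum>d\<in>UNIV. F c d"]
    by (simp add: sum.reindex_bij_betw[OF h])
  have "block_psd CARD('c) (\<lambda>i j. X (h i) (h j))"
    unfolding block_psd_def
  proof
    fix w :: "nat \<Rightarrow> complex ^ 'a"
    define g where "g = inv_into {..<CARD('c)} h"
    have g: "g (h i) = i" if "i < CARD('c)" for i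
      using that h by (simp add: g_def bij_betw_def)
    have "(\<Sum>i<CARD('c). \<Sum>j<CARD('c). cinner (w i) (X (h i) (h j) *v w j)) =
        (\<Sum>i<CARD('c). \<Sum>j<CARD('c). cinner (w (g (h i))) (X (h i) (h j) *v w (g (h j))))"
      by (simp add: g)
    also have "\<dots> = (\<Sum>c\<in>UNIV. \<Sum>d\<in>UNIV. cinner (w (g c)) (X c d *v w (g d)))"
      by (rule reindex)
    finally show "(\<Sum>i<CARD('c). \<Sum>j<CARD('c). cinner (w i) (X (h i) (h j) *v w j)) \<in> \<real>\<^sub>\<ge>\<^sub>0"
      using X[of "\<lambda>c. w (g c)"] by simp
  qed
  then have "block_psd CARD('c) (\<lambda>i j. N (X (h i) (h j)))"
    using cp by (simp add: completely_positive_def)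
  then have "(\<Sum>i<CARD('c). \<Sum>j<CARD('c). cinner (v (h i)) (N (X (h i) (h j)) *v v (h j))) \<in> \<real>\<^sub>\<ge>\<^sub>0"
    by (simp add: block_psd_def)
  then show ?thesis by (simp add: reindex[of "\<lambda>c d. cinner (v c) (N (X c d) *v v d)"])
qed

text \<open>A vector on the product is a family of vectors on the first system indexed by the
  second, and the form rearranges accordingly: the second system is the ancilla.\<close>

lemma psd_blocks_fst:
  fixes X :: "('a::finite \<times> 'c::finite) op"
  shows "psd X \<longleftrightarrow>
    (\<forall>v. (\<Sum>c\<in>UNIV. \<Sum>d\<in>UNIV. cinner (v c) ((\<chi> i j. X $ (i, c) $ (j, d)) *v v d)) \<in> \<real>\<^sub>\<ge>\<^sub>0)"
proof -
  have form: "cinner w (X *v w) =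
    (\<Sum>c\<in>UNIV. \<Sum>d\<in>UNIV. cinner (\<chi> i. w $ (i, c)) ((\<chi> i j. X $ (i, c) $ (j, d)) *v (\<chi> i. w $ (i, d))))"
    for w
  proof -
    have "cinner w (X *v w) = (\<Sum>i\<in>UNIV. \<Sum>c\<in>UNIV. \<Sum>j\<in>UNIV. \<Sum>d\<in>UNIV.
        cnj (w $ (i, c)) * X $ (i, c) $ (j, d) * w $ (j, d))"
      by (simp add: cinner_matrix sum_UNIV_prod)
    also have "\<dots> = (\<Sum>c\<in>UNIV. \<Sum>i\<in>UNIV. \<Sum>d\<in>UNIV. \<Sum>j\<in>UNIV.
        cnj (w $ (i, c)) * X $ (i, c) $ (j, d) * w $ (j, d))"
      by (subst sum.swap) (intro sum.cong[OF refl] sum.swap)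
    also have "\<dots> = (\<Sum>c\<in>UNIV. \<Sum>d\<in>UNIV. \<Sum>i\<in>UNIV. \<Sum>j\<in>UNIV.
        cnj (w $ (i, c)) * X $ (i, c) $ (j, d) * w $ (j, d))"
      by (intro sum.cong[OF refl] sum.swap)
    finally show ?thesis by (simp add: cinner_matrix)
  qed
  show ?thesis
  proof
    assume "psd X"
    then have "cinner (\<chi> p. v (snd p) $ fst p) (X *v (\<chi> p. v (snd p) $ fst p)) \<in> \<real>\<^sub>\<ge>\<^sub>0" for v
      by (simp add: psd_def)
    then show "\<forall>v. (\<Sum>c\<in>UNIV. \<Sum>d\<in>UNIV.
        cinner (v c) ((\<chi> i j. X $ (i, c) $ (j, d)) *v v d)) \<in> \<real>\<^sub>\<ge>\<^sub>0"
      unfolding form by simp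
  qed (simp add: psd_def form)
qed

lemma psd_blocks_snd:
  fixes X :: "('c::finite \<times> 'a::finite) op"
  shows "psd X \<longleftrightarrow>
    (\<forall>v. (\<Sum>c\<in>UNIV. \<Sum>d\<in>UNIV. cinner (v c) ((\<chi> i j. X $ (c, i) $ (d, j)) *v v d)) \<in> \<real>\<^sub>\<ge>\<^sub>0)"
proof -
  have form: "cinner w (X *v w) =
    (\<Sum>c\<in>UNIV. \<Sum>d\<in>UNIV. cinner (\<chi> i. w $ (c, i)) ((\<chi> i j. X $ (c, i) $ (d, j)) *v (\<chi> i. w $ (d, i))))"
    for w
  proof -
    have "cinner w (X *v w) = (\<Sum>c\<in>UNIV. \<Sum>i\<in>UNIV. \<Sum>d\<in>UNIV. \<Sum>j\<in>UNIV.
        cnj (w $ (c, i)) * X $ (c, i) $ (d, j) * w $ (d, j))"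
      by (simp add: cinner_matrix sum_UNIV_prod)
    also have "\<dots> = (\<Sum>c\<in>UNIV. \<Sum>d\<in>UNIV. \<Sum>i\<in>UNIV. \<Sum>j\<in>UNIV.
        cnj (w $ (c, i)) * X $ (c, i) $ (d, j) * w $ (d, j))"
      by (intro sum.cong[OF refl] sum.swap)
    finally show ?thesis by (simp add: cinner_matrix)
  qed
  show ?thesis
  proof
    assume "psd X"
    then have "cinner (\<chi> p. v (fst p) $ snd p) (X *v (\<chi> p. v (fst p) $ snd p)) \<in> \<real>\<^sub>\<ge>\<^sub>0" for v
      by (simp add: psd_def)
    then show "\<forall>v. (\<Sum>c\<in>UNIV. \<Sum>d\<in>UNIV.
        cinner (v c) ((\<chi> i j. X $ (c, i) $ (d, j)) *v v d)) \<in> \<real>\<^sub>\<ge>\<^sub>0"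
      unfolding form by simp
  qed (simp add: psd_def form)
qed

lemma state_channel:
  assumes "channel N" and "state \<rho>"
  shows "state (N \<rho>)"
proof -
  have "psd (N \<rho>)"
    unfolding psd_def
  proof
    fix v
    \<comment> \<open>Plain positivity is complete positivity with a one-dimensional ancilla,
      indexed by \<open>unit\<close>.\<close>
    show "cinner v (N \<rho> *v v) \<in> \<real>\<^sub>\<ge>\<^sub>0"
      using assms completely_positive_blocks[of N "\<lambda>(_::unit) _. \<rho>" "\<lambda>_. v"]
      by (simp add: channel_def state_def psd_def UNIV_unit)
  qed
  then show ?thesis using assms by (simp add: channel_def state_def)
qed

text \<open>The product channel acts as \<open>N1\<close> on the blocks indexed by the second system, and then as
  \<open>N2\<close> on the blocks indexed by the first one.\<close>

lemma psd_tensor_map: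
  fixes N1 :: "'a1::finite op \<Rightarrow> 'b1::finite op" and N2 :: "'a2::finite op \<Rightarrow> 'b2::finite op"
  assumes N: "channel N1" "channel N2" and X: "psd X"
  shows "psd (tensor_map N1 N2 X)"
proof -
  define Y :: "('b1 \<times> 'a2) op" where
    "Y = (\<chi> p q. N1 (\<chi> i j. X $ (i, snd p) $ (j, snd q)) $ fst p $ fst q)"
  have "psd Y"
    unfolding psd_blocks_fst
  proof
    fix v :: "'a2 \<Rightarrow> complex ^ 'b1"
    have "(\<chi> i j. Y $ (i, c) $ (j, d)) = N1 (\<chi> i j. X $ (i, c) $ (j, d))" for c d
      by (simp add: Y_def vec_eq_iff)
    then show "(\<Sum>c\<in>UNIV. \<Sum>d\<in>UNIV. cinner (v c) ((\<chi> i j. Y $ (i, c) $ (j, d)) *v v d)) \<in> \<real>\<^sub>\<ge>\<^sub>0"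
      using N X completely_positive_blocks[of N1 "\<lambda>c d. \<chi> i j. X $ (i, c) $ (j, d)" v]
      by (simp add: channel_def psd_blocks_fst)
  qed
  have "psd (\<chi> p q. N2 (\<chi> k l. Y $ (fst p, k) $ (fst q, l)) $ snd p $ snd q)" (is "psd ?Z")
    unfolding psd_blocks_snd
  proof
    fix v :: "'b1 \<Rightarrow> complex ^ 'b2"
    have "(\<chi> i j. ?Z $ (c, i) $ (d, j)) = N2 (\<chi> k l. Y $ (c, k) $ (d, l))" for c d
      by (simp add: vec_eq_iff)
    then show "(\<Sum>c\<in>UNIV. \<Sum>d\<in>UNIV. cinner (v c) ((\<chi> i j. ?Z $ (c, i) $ (d, j)) *v v d)) \<in> \<real>\<^sub>\<ge>\<^sub>0"
      using N \<open>psd Y\<close> completely_positive_blocks[of N2 "\<lambda>c d. \<chi> k l. Y $ (c, k) $ (d, l)" v]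
      by (simp add: channel_def psd_blocks_snd)
  qed
  moreover have "?Z = tensor_map N1 N2 X"
  proof -
    have lin: "Vector_Spaces.linear mscale mscale N1" "Vector_Spaces.linear mscale mscale N2"
      using N by (simp_all add: channel_def)
    have "?Z $ p $ q = tensor_map N1 N2 X $ p $ q" for p q
    proof -
      let ?F = "\<lambda>i k j l. X $ (i, k) $ (j, l) *
        (N1 (mat_unit i j) $ fst p $ fst q * N2 (mat_unit k l) $ snd p $ snd q)"
      have "?Z $ p $ q = (\<Sum>k\<in>UNIV. \<Sum>l\<in>UNIV. Y $ (fst p, k) $ (fst q, l) * N2 (mat_unit k l) $ snd p $ snd q)"
        by (simp add: linear_mat_unit[OF lin(2), of "\<chi> k l. _ k l"] mscale_def)
      also have "\<dots> = (\<Sum>k\<in>UNIV. \<Sum>l\<in>UNIV. \<Sum>i\<in>UNIV. \<Sum>j\<in>UNIV. ?F i k j l)"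
        by (simp add: Y_def linear_mat_unit[OF lin(1), of "\<chi> k l. _ k l"] mscale_def
            sum_distrib_right mult.assoc)
      also have "\<dots> = (\<Sum>k\<in>UNIV. \<Sum>i\<in>UNIV. \<Sum>j\<in>UNIV. \<Sum>l\<in>UNIV. ?F i k j l)"
        by (rule sum.cong[OF refl], subst sum.swap, intro sum.cong[OF refl] sum.swap)
      also have "\<dots> = (\<Sum>i\<in>UNIV. \<Sum>k\<in>UNIV. \<Sum>j\<in>UNIV. \<Sum>l\<in>UNIV. ?F i k j l)"
        by (rule sum.swap)
      finally show ?thesis by (simp add: tensor_map_def tensor_def mscale_def)
    qed
    then show ?thesis by (simp add: vec_eq_iff)
  qed
  ultimately show ?thesis by simp
qed

lemma trace_mat_unit: "trace (mat_unit i j) = (if i = j then 1 else 0)"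
proof -
  have "trace (mat_unit i j) = (\<Sum>k\<in>UNIV. if k = i then if i = j then 1 else 0 else 0)"
    unfolding trace_def mat_unit_def by (rule sum.cong) auto
  then show ?thesis by simp
qed

text \<open>Trace preservation of \<open>N2\<close> turns the traces of the
  \<open>N2 (mat_unit k l)\<close> into Kronecker deltas, which collapse the remaining sum to the
  partial trace of \<open>X\<close>.\<close>

lemma marginal1_tensor_map:
  assumes "channel N1" and "channel N2"
  shows "marginal1 (tensor_map N1 N2 X) = N1 (marginal1 X)"
proof -
  have lin: "Vector_Spaces.linear mscale mscale N1" using assms by (simp add: channel_def)
  have sum: "marginal1 (\<Sum>x\<in>S. f x) = (\<Sum>x\<in>S. marginal1 (f x))"
    for S and f :: "_ \<Rightarrow> ('x::finite \<times> 'y::finite) op"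
    by (simp add: marginal1_def vec_eq_iff) (intro allI sum.swap)
  have scale: "marginal1 (mscale c A) = mscale c (marginal1 A)" for c A
    by (simp add: marginal1_def mscale_def vec_eq_iff sum_distrib_left)
  have "marginal1 (tensor_map N1 N2 X) $ p $ q = N1 (marginal1 X) $ p $ q" for p q
  proof -
    have "marginal1 (tensor_map N1 N2 X) $ p $ q =
        (\<Sum>i\<in>UNIV. \<Sum>k\<in>UNIV. \<Sum>j\<in>UNIV. X $ (i, k) $ (j, k) * N1 (mat_unit i j) $ p $ q)"
      unfolding tensor_map_def sum scale marginal1_tensor using assms
      by (simp add: channel_def trace_mat_unit mscale_def if_distrib[of "(*) _"]
          if_distrib[of "\<lambda>x. x * _"] cong: if_cong)
    also have "\<dots> = (\<Sum>i\<in>UNIV. \<Sum>j\<in>UNIV. \<Sum>k\<in>UNIV. X $ (i, k) $ (j, k) * N1 (mat_unit i j) $ p $ q)"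
      by (intro sum.cong[OF refl] sum.swap)
    also have "\<dots> = N1 (marginal1 X) $ p $ q"
      by (subst linear_mat_unit[OF lin]) (simp add: mscale_def marginal1_def sum_distrib_right)
    finally show ?thesis .
  qed
  then show ?thesis by (simp add: vec_eq_iff)
qed

lemma marginal2_tensor_map:
  assumes "channel N1" and "channel N2"
  shows "marginal2 (tensor_map N1 N2 X) = N2 (marginal2 X)"
proof -
  have lin: "Vector_Spaces.linear mscale mscale N2" using assms by (simp add: channel_def)
  have sum: "marginal2 (\<Sum>x\<in>S. f x) = (\<Sum>x\<in>S. marginal2 (f x))"
    for S and f :: "_ \<Rightarrow> ('x::finite \<times> 'y::finite) op"
    by (simp add: marginal2_def vec_eq_iff) (intro allI sum.swap)
  have scale: "marginal2 (mscale c A) = mscale c (marginal2 A)" for c A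
    by (simp add: marginal2_def mscale_def vec_eq_iff sum_distrib_left)
  have "marginal2 (tensor_map N1 N2 X) $ p $ q = N2 (marginal2 X) $ p $ q" for p q
  proof -
    let ?F = "\<lambda>i k j l. if i = j then X $ (i, k) $ (j, l) * N2 (mat_unit k l) $ p $ q else 0"
    have "marginal2 (tensor_map N1 N2 X) $ p $ q =
        (\<Sum>i\<in>UNIV. \<Sum>k\<in>UNIV. \<Sum>j\<in>UNIV. \<Sum>l\<in>UNIV. ?F i k j l)"
      unfolding tensor_map_def sum scale marginal2_tensor using assms
      by (simp add: channel_def trace_mat_unit mscale_def if_distrib[of "(*) _"]
          if_distrib[of "\<lambda>x. x * _"] cong: if_cong)
    also have "\<dots> = (\<Sum>i\<in>UNIV. \<Sum>k\<in>UNIV. \<Sum>l\<in>UNIV. \<Sum>j\<in>UNIV. ?F i k j l)"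
      by (intro sum.cong[OF refl] sum.swap)
    also have "\<dots> = (\<Sum>k\<in>UNIV. \<Sum>l\<in>UNIV. \<Sum>i\<in>UNIV. \<Sum>j\<in>UNIV. ?F i k j l)"
      by (subst sum.swap) (intro sum.cong[OF refl] sum.swap)
    also have "\<dots> = N2 (marginal2 X) $ p $ q"
      by (subst linear_mat_unit[OF lin]) (simp add: mscale_def marginal2_def sum_distrib_right)
    finally show ?thesis .
  qed
  then show ?thesis by (simp add: vec_eq_iff)
qed

lemma state_tensor_map:
  assumes N: "channel N1" "channel N2" and X: "state X"
  shows "state (tensor_map N1 N2 X)"
proof -
  have "trace (tensor_map N1 N2 X) = trace (N1 (marginal1 X))"
    using trace_marginal1[of "tensor_map N1 N2 X" "mat 1"] marginal1_tensor_map[OF N, of X]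
    by (simp add: tensor_one)
  then show ?thesis
    using N X state_marginals(1)[OF X] by (simp add: state_def psd_tensor_map channel_def)
qed

section \<open>Suprema of ratios\<close>

lemma sup_ratio_bound:
  assumes "x \<in> S" "0 < g x" "g x < \<infinity>"
  shows "f x \<le> sup_ratio S f g * g x"
proof -
  have "f x / g x \<le> sup_ratio S f g"
    using assms by (auto simp: sup_ratio_def Let_def intro: SUP_upper)
  then show ?thesis using assms by (simp add: ereal_divide_le_pos mult.commute)
qed

lemma sup_ratio_nonneg:
  assumes "\<And>x. x \<in> S \<Longrightarrow> 0 \<le> f x"
  shows "0 \<le> sup_ratio S f g"
proof (cases "{x \<in> S. 0 < g x \<and> g x < \<infinity>} = {}")
  case False
  then obtain x where x: "x \<in> S" "0 < g x" "g x < \<infinity>" by blast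
  then have "0 \<le> f x / g x" using assms by (simp add: zero_le_divide_ereal)
  also have "f x / g x \<le> sup_ratio S f g"
    using x by (auto simp: sup_ratio_def Let_def intro: SUP_upper)
  finally show ?thesis .
qed (simp add: sup_ratio_def)

text \<open>The hypothesis \<open>0 \<le> c\<close> covers the case without admissible points, where
  the value is 0 by convention; this is why nonnegativity of the coefficients is
  established.\<close>

lemma sup_ratio_least:
  assumes "0 \<le> c" and "\<And>x. x \<in> S \<Longrightarrow> 0 < g x \<Longrightarrow> g x < \<infinity> \<Longrightarrow> f x \<le> c * g x"
  shows "sup_ratio S f g \<le> c"
  using assms
  by (auto simp: sup_ratio_def Let_def ereal_divide_le_pos mult.commute intro!: SUP_least)

lemma eta_D_nonneg:
  assumes "\<And>\<rho>. state \<rho> \<Longrightarrow> state (N \<rho>)" and "state \<sigma>"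
  shows "0 \<le> eta_D N \<sigma>"
  unfolding eta_D_def using assms by (intro sup_ratio_nonneg) (auto intro: rel_entropy_klein)

lemma eta_D_bound:
  assumes "state \<rho>" "state \<sigma>" and fin: "rel_entropy \<rho> \<sigma> < \<infinity>"
  shows "rel_entropy (N \<rho>) (N \<sigma>) \<le> eta_D N \<sigma> * rel_entropy \<rho> \<sigma>"
proof (cases "\<rho> = \<sigma>")
  case False
  then have "0 < rel_entropy \<rho> \<sigma>"
    using rel_entropy_klein[OF assms(1,2)] by (simp add: order_less_le)
  then show ?thesis
    unfolding eta_D_def using assms False
    by (intro sup_ratio_bound[where f = "\<lambda>\<rho>. rel_entropy (N \<rho>) (N \<sigma>)" and g = "\<lambda>\<rho>. rel_entropy \<rho> \<sigma>"]) auto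
\<comment> \<open>For equal states both relative entropies are 0, and in \<open>ereal\<close> a
  product with 0 is 0 whatever the coefficient.\<close>
qed simp

lemma zeta_MI_bound:
  assumes N: "channel N1" "channel N2" and \<rho>: "state \<rho>" and fin: "mutual_info \<rho> < \<infinity>"
  shows "mutual_info (tensor_map N1 N2 \<rho>) \<le> zeta_MI (tensor_map N1 N2) * mutual_info \<rho>"
proof (cases "product_state \<rho>")
  case True
  then obtain A B where AB: "state A" "state B" "\<rho> = tensor A B"
    by (auto simp: product_state_def)
  then have "tensor_map N1 N2 \<rho> = tensor (N1 A) (N2 B)"
    using N by (simp add: tensor_map_tensor channel_def)
  then show ?thesis using AB N by (simp add: mutual_info_tensor state_channel)
next
  case False
  then have "0 < mutual_info \<rho>"
    using mutual_info_nonneg[OF \<rho>] mutual_info_eq_0D[OF \<rho>] by (auto simp: order_less_le)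
  then show ?thesis
    unfolding zeta_MI_def using \<rho> False fin
    by (intro sup_ratio_bound[where g = mutual_info and f = "\<lambda>\<rho>. mutual_info (tensor_map N1 N2 \<rho>)"]) auto
qed

lemma rel_entropy_tensor_states:
  assumes "state A" "state B" "state A'" "state B'"
  shows "rel_entropy (tensor A B) (tensor A' B') = rel_entropy A A' + rel_entropy B B'"
proof -
  have "marginal1 (tensor A B) = A" "marginal2 (tensor A B) = B"
    using assms by (simp_all add: marginal1_tensor marginal2_tensor state_def)
  then show ?thesis
    using assms by (simp add: rel_entropy_tensor state_tensor mutual_info_tensor)
qed

theorem mainTheorem10:
  fixes N1 :: "'a1::finite op \<Rightarrow> 'b1::finite op"
    and N2 :: "'a2::finite op \<Rightarrow> 'b2::finite op"
    and \<sigma>1 :: "'a1 op" and \<sigma>2 :: "'a2 op"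
  assumes "channel N1" and "channel N2"
    and "state \<sigma>1" and "state \<sigma>2"
  shows "max (eta_D N1 \<sigma>1) (eta_D N2 \<sigma>2) \<le> eta_D (tensor_map N1 N2) (tensor \<sigma>1 \<sigma>2) \<and>
         eta_D (tensor_map N1 N2) (tensor \<sigma>1 \<sigma>2)
           \<le> max (zeta_MI (tensor_map N1 N2)) (max (eta_D N1 \<sigma>1) (eta_D N2 \<sigma>2))"
proof -
  note N = assms(1,2) and \<sigma> = assms(3,4)
  let ?N = "tensor_map N1 N2" and ?\<sigma> = "tensor \<sigma>1 \<sigma>2"
  have N\<sigma>: "?N ?\<sigma> = tensor (N1 \<sigma>1) (N2 \<sigma>2)"
    using N by (simp add: tensor_map_tensor channel_def)
  have st: "state ?\<sigma>" "state (N1 \<sigma>1)" "state (N2 \<sigma>2)"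
    using N \<sigma> by (simp_all add: state_tensor state_channel)
  have nonneg: "0 \<le> eta_D ?N ?\<sigma>" "0 \<le> eta_D N1 \<sigma>1"
    using eta_D_nonneg[of ?N, OF state_tensor_map[OF N] st(1)] eta_D_nonneg[of N1, OF state_channel[OF N(1)] \<sigma>(1)]
    by simp_all
  have D: "rel_entropy (tensor \<rho>1 \<rho>2) ?\<sigma> = rel_entropy \<rho>1 \<sigma>1 + rel_entropy \<rho>2 \<sigma>2"
    "rel_entropy (?N (tensor \<rho>1 \<rho>2)) (?N ?\<sigma>) =
       rel_entropy (N1 \<rho>1) (N1 \<sigma>1) + rel_entropy (N2 \<rho>2) (N2 \<sigma>2)"
    if "state \<rho>1" "state \<rho>2" for \<rho>1 \<rho>2
  proof -
    have "?N (tensor \<rho>1 \<rho>2) = tensor (N1 \<rho>1) (N2 \<rho>2)"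
      using N by (simp add: tensor_map_tensor channel_def)
    then show "rel_entropy (tensor \<rho>1 \<rho>2) ?\<sigma> = rel_entropy \<rho>1 \<sigma>1 + rel_entropy \<rho>2 \<sigma>2"
      "rel_entropy (?N (tensor \<rho>1 \<rho>2)) (?N ?\<sigma>) =
         rel_entropy (N1 \<rho>1) (N1 \<sigma>1) + rel_entropy (N2 \<rho>2) (N2 \<sigma>2)"
      using that N \<sigma> by (simp_all add: N\<sigma> rel_entropy_tensor_states state_channel)
  qed
  have lower1: "eta_D N1 \<sigma>1 \<le> eta_D ?N ?\<sigma>"
    unfolding eta_D_def[of N1]
  proof (rule sup_ratio_least[OF nonneg(1)])
    fix \<rho> assume \<rho>: "\<rho> \<in> {\<rho>. state \<rho> \<and> \<rho> \<noteq> \<sigma>1}" and fin: "rel_entropy \<rho> \<sigma>1 < \<infinity>"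
    \<comment> \<open>The factor \<sigma>2 adds 0 both before and after the channel, so the product
      inequality for \<open>tensor \<rho> \<sigma>2\<close> is the one for the first system.\<close>
    then show "rel_entropy (N1 \<rho>) (N1 \<sigma>1) \<le> eta_D ?N ?\<sigma> * rel_entropy \<rho> \<sigma>1"
      using eta_D_bound[OF state_tensor st(1), of \<rho> \<sigma>2 ?N] \<sigma> D[of \<rho> \<sigma>2] by simp
  qed
  have lower2: "eta_D N2 \<sigma>2 \<le> eta_D ?N ?\<sigma>"
    unfolding eta_D_def[of N2]
  proof (rule sup_ratio_least[OF nonneg(1)])
    fix \<rho> assume \<rho>: "\<rho> \<in> {\<rho>. state \<rho> \<and> \<rho> \<noteq> \<sigma>2}" and fin: "rel_entropy \<rho> \<sigma>2 < \<infinity>"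
    then show "rel_entropy (N2 \<rho>) (N2 \<sigma>2) \<le> eta_D ?N ?\<sigma> * rel_entropy \<rho> \<sigma>2"
      using eta_D_bound[OF state_tensor st(1), of \<sigma>1 \<rho> ?N] \<sigma> D[of \<sigma>1 \<rho>] by simp
  qed
  define c where "c = max (zeta_MI ?N) (max (eta_D N1 \<sigma>1) (eta_D N2 \<sigma>2))"
  have c: "zeta_MI ?N \<le> c" "eta_D N1 \<sigma>1 \<le> c" "eta_D N2 \<sigma>2 \<le> c"
    by (simp_all add: c_def le_max_iff_disj)
  have c0: "0 \<le> c" using c(2) nonneg(2) by (rule order_trans[rotated])
  have "eta_D ?N ?\<sigma> \<le> c"
    unfolding eta_D_def
  proof (rule sup_ratio_least[OF c0])
    fix \<rho> assume "\<rho> \<in> {\<rho>. state \<rho> \<and> \<rho> \<noteq> ?\<sigma>}" and fin: "rel_entropy \<rho> ?\<sigma> < \<infinity>"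
    then have \<rho>: "state \<rho>" by simp
    note m = state_marginals[OF \<rho>]
    let ?I = "mutual_info \<rho>" and ?D1 = "rel_entropy (marginal1 \<rho>) \<sigma>1"
      and ?D2 = "rel_entropy (marginal2 \<rho>) \<sigma>2"
    have pos: "0 \<le> ?I" "0 \<le> ?D1" "0 \<le> ?D2"
      using \<rho> m \<sigma> by (auto intro: mutual_info_nonneg rel_entropy_klein)
    have chain: "rel_entropy \<rho> ?\<sigma> = ?I + ?D1 + ?D2"
      using \<rho> \<sigma> by (rule rel_entropy_tensor)
    have finite: "?I < \<infinity>" "?D1 < \<infinity>" "?D2 < \<infinity>"
      using fin pos unfolding chain by auto
    have "mutual_info (?N \<rho>) \<le> c * ?I"
      using zeta_MI_bound[OF N \<rho> finite(1)] ereal_mult_right_mono[OF c(1) pos(1)] by order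
    moreover have "rel_entropy (N1 (marginal1 \<rho>)) (N1 \<sigma>1) \<le> c * ?D1"
      using eta_D_bound[OF m(1) \<sigma>(1) finite(2), of N1] ereal_mult_right_mono[OF c(2) pos(2)] by order
    moreover have "rel_entropy (N2 (marginal2 \<rho>)) (N2 \<sigma>2) \<le> c * ?D2"
      using eta_D_bound[OF m(2) \<sigma>(2) finite(3), of N2] ereal_mult_right_mono[OF c(3) pos(3)] by order
    moreover have "rel_entropy (?N \<rho>) (?N ?\<sigma>) = mutual_info (?N \<rho>) +
        rel_entropy (N1 (marginal1 \<rho>)) (N1 \<sigma>1) + rel_entropy (N2 (marginal2 \<rho>)) (N2 \<sigma>2)"
      using rel_entropy_tensor[OF state_tensor_map[OF N \<rho>] st(2,3)]
      by (simp add: N\<sigma> marginal1_tensor_map[OF N] marginal2_tensor_map[OF N])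
    ultimately have "rel_entropy (?N \<rho>) (?N ?\<sigma>) \<le> c * ?I + c * ?D1 + c * ?D2"
      by (simp add: add_mono)
    also have "\<dots> = c * rel_entropy \<rho> ?\<sigma>"
      \<comment> \<open>Distributivity in \<open>ereal\<close> rests on the nonnegative summands, as
        \<open>c\<close> has not been shown to be finite.\<close>
      unfolding chain using pos by (simp add: ereal_right_distrib)
    finally show "rel_entropy (?N \<rho>) (?N ?\<sigma>) \<le> c * rel_entropy \<rho> ?\<sigma>" .
  qed
  with lower1 lower2 show ?thesis by (simp add: c_def)
qed

end
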